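(* Fix a boundary condition $\hat{\mathbf{A}}\in\mathcal{B}^{\mathbb{C}}$ with $\mu_1=0$ and $\mu_2=0$. Then $\hat{\mathbf{A}}$ can be written as either $$\hat{\mathbf{A}}_1=\left[\begin{array}{cccc}\hat a_{11}&-1&0&0\\0&0&-1&0\end{array}\right]\quad\text{or}\quad \hat{\mathbf{A}}_2=\left[\begin{array}{cccc}1&\hat a_{12}&0&0\\0&0&-1&0\end{array}\right]$$ with $\hat a_{11}\in\mathbb{R}$, respectively $\hat a_{12}\in\mathbb{R}$. Write $\lambda_n(\boldsymbol\omega):=\lambda_n(\boldsymbol\omega,\hat{\mathbf{A}})$. (i) If $\hat{\mathbf{A}}=\hat{\mathbf{A}}_1$ with $\hat a_{11}\ne0$, then $(\boldsymbol\omega,\hat{\mathbf{A}})$ has exactly $N-2$ eigenvalues for each $\boldsymbol\omega\in\mathcal{E}_1$, and exactly $N-1$ eigenvalues $\lambda_n(\boldsymbol\omega)$, $0\le n\le N-2$, for each $\boldsymbol\omega\in\Omega_N^{\mathbb{R},+}\setminus\mathcal{E}_1$, which satisfy: (ia) each $\lambda_n$, $0\le n\le N-2$, is continuous in $\Omega_N^{\mathbb{R},+}\setminus\mathcal{E}_1$; (ib) each $\lambda_n$, $0\le n\le N-2$, restricted to each connected component of $\mathcal{E}_1^+$ or $\mathcal{E}_1^-$ has the monotonicity property (M); (ic) the $\lambda_n$, $0\le n\le N-2$, are not continuous at each point of $\mathcal{E}_1$, and near any given $\boldsymbol\omega_0\in\mathcal{E}_1$: $$\lim_{\mathcal{E}_1^-\ni\boldsymbol\omega\to\boldsymbol\omega_0}\lambda_0(\boldsymbol\omega)=-\infty,\quad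 \lim_{\mathcal{E}_1^-\ni\boldsymbol\omega\to\boldsymbol\omega_0}\lambda_n(\boldsymbol\omega)=\lambda_{n-1}(\boldsymbol\omega_0),\ 1\le n\le N-2,$$ $$\lim_{\mathcal{E}_1^+\cup\mathcal{E}_1\ni\boldsymbol\omega\to\boldsymbol\omega_0}\lambda_n(\boldsymbol\omega)=\lambda_n(\boldsymbol\omega_0),\ 0\le n\le N-3,\quad \lim_{\mathcal{E}_1^+\ni\boldsymbol\omega\to\boldsymbol\omega_0}\lambda_{N-2}(\boldsymbol\omega)=+\infty.$$ Consequently, $\lambda_n$ restricted to $\mathcal{E}_1^+\cup\mathcal{E}_1$ is continuous for each $0\le n\le N-3$. (ii) If $\hat{\mathbf{A}}=\hat{\mathbf{A}}_2$ with $\hat a_{12}\ne0$, then all the conclusions in (i) hold with $\mathcal{E}_1,\mathcal{E}_1^+,\mathcal{E}_1^-$ replaced by $\mathcal{E}_2,\mathcal{E}_2^+,\mathcal{E}_2^-$, respectively. (iii) If $\hat{\mathbf{A}}=\hat{\mathbf{A}}_1$ with $\hat a_{11}=0$ or $\hat{\mathbf{A}}=\hat{\mathbf{A}}_2$ with $\hat a_{12}=0$, then $(\boldsymbol\omega,\hat{\mathbf{A}})$ has exactly $N-1$ eigenvalues $\lambda_n(\boldsymbol\omega)$, $0\le n\le N-2$, for each $\boldsymbol\omega\in\Omega_N^{\mathbb{R},+}$; each $\lambda_n$ is continuous in $\Omega_N^{\mathbb{R},+}$; and each $\lambda_n$ restricted to each connected component of $\Omega_N^{\mathbb{R},+}$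 has the monotonicity property (M).
   Context: Fix an integer $N\ge 2$. A self-adjoint discrete Sturm–Liouville problem is a pair $(\boldsymbol\omega,\mathbf{A})$. Here $\boldsymbol\omega=(1/f,q,w)$ with real sequences $f=\{f_n\}_{n=0}^N$, $q=\{q_n\}_{n=1}^N$, $w=\{w_n\}_{n=1}^N$, $f_n\ne0$, $w_n>0$, encodes the equation $-\nabla(f_n\Delta y_n)+q_ny_n=\lambda w_ny_n$, $1\le n\le N$, for $y=(y_0,\dots,y_{N+1})$, with $\Delta y_n=y_{n+1}-y_n$, $\nabla y_n=y_n-y_{n-1}$; the set $\Omega_N^{\mathbb{R},+}$ of all such $(1/f,q,w)$ has the topology of a subset of $\mathbb{R}^{3N+1}$, with coordinates $1/f_0,\dots,1/f_N,q_1,\dots,q_N,w_1,\dots,w_N$. $\mathbf{A}=[A\,|\,B]$ encodes the boundary condition $A\begin{pmatrix}y_0\\ f_0\Delta y_0\end{pmatrix}+B\begin{pmatrix}y_N\\ f_N\Delta y_N\end{pmatrix}=0$, where $A,B$ are complex $2\times2$ matrices with $\mathrm{rank}(A,B)=2$ and $AJA^*=BJB^*$, $J=\begin{pmatrix}0&1\\-1&0\end{pmatrix}$; $[A\,|\,B]$ is the class of $(A,B)$ modulo left multiplication by $GL(2,\mathbb{C})$, and $\mathcal{B}^{\mathbb{C}}$ is the set of all such classes. An eigenvalue of $(\boldsymbol\omega,\mathbf{A})$ is a $\lambda$ for which a nonzero $y$ solves the equation and the boundary condition. Eigenvalues are real and finite in number; they are counted with multiplicity (the dimension of the solution space) and listed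 as $\lambda_0\le\lambda_1\le\cdots$; $\lambda_n$ is defined at a problem only if it has more than $n$ eigenvalues, and $\lambda_n$ is regarded as not continuous at a point where it is not defined. Assertions over empty ranges of $n$ are vacuous. Write $\hat{\mathbf{A}}=\left[\begin{array}{cccc}\hat a_{11}&\hat a_{12}&\hat b_{11}&\hat b_{12}\\ \hat a_{21}&\hat a_{22}&\hat b_{21}&\hat b_{22}\end{array}\right]$ (left half $A$, right half $B$), $\mu_1:=\hat a_{11}\hat b_{22}-\hat a_{21}\hat b_{12}$, $\mu_2:=\hat a_{22}\hat b_{12}-\hat a_{12}\hat b_{22}$. For $\hat a_{11}\neq0$, $\mathcal{E}_1$, $\mathcal{E}_1^+$, $\mathcal{E}_1^-$ are the sets of $\boldsymbol\omega\in\Omega_N^{\mathbb{R},+}$ with $1/f_0=-1/\hat a_{11}$, $1/f_0>-1/\hat a_{11}$, $1/f_0<-1/\hat a_{11}$, respectively. $\mathcal{E}_2$, $\mathcal{E}_2^+$, $\mathcal{E}_2^-$ are the sets of $\boldsymbol\omega$ with $1/f_0=\hat a_{12}$, $1/f_0>\hat a_{12}$, $1/f_0<\hat a_{12}$, respectively. Monotonicity property (M) of a function $\lambda_n$ on a set: it is non-increasing in every $(1/f_j)$-direction ($0\le j\le N-1$), independent of $f_N$, non-decreasing in every $q_j$-direction ($1\le j\le N$), and $\max\{\lambda_n,0\}$ and $\min\{\lambda_n,0\}$ are respectively non-increasing and non-decreasing in every $w_j$-direction ($1\le j\le N$); a coordinate direction means varying that coordinate with all others fixed. *)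

theory Defs
  imports "HOL-Analysis.Analysis" "HOL-Library.Function_Algebras"
begin

text \<open>
  A point \<open>(r, q, w)\<close> of type \<open>sl_eq\<close> is the coordinate tuple of an equation, \<open>r j\<close> being the
  coordinate \<open>1/f_j\<close>. The sequences are padded with zeros outside their index ranges, so that
  \<open>Omega N\<close>, with the topology inherited from the product topology of \<open>sl_eq\<close>, is homeomorphic to
  the corresponding subset of the \<open>(3N+1)\<close>-dimensional real space.
\<close>

type_synonym sl_eq = "(nat \<Rightarrow> real) \<times> (nat \<Rightarrow> real) \<times> (nat \<Rightarrow> real)"

definition rec_f :: "sl_eq \<Rightarrow> nat \<Rightarrow> real" where
  "rec_f \<omega> = fst \<omega>"

definition coef_f :: "sl_eq \<Rightarrow> nat \<Rightarrow> real" where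
  "coef_f \<omega> n = 1 / rec_f \<omega> n"

definition coef_q :: "sl_eq \<Rightarrow> nat \<Rightarrow> real" where
  "coef_q \<omega> = fst (snd \<omega>)"

definition coef_w :: "sl_eq \<Rightarrow> nat \<Rightarrow> real" where
  "coef_w \<omega> = snd (snd \<omega>)"

definition Omega :: "nat \<Rightarrow> sl_eq set" where
  "Omega N = {\<omega>. (\<forall>n\<in>{0..N}. rec_f \<omega> n \<noteq> 0) \<and> (\<forall>n. n \<notin> {0..N} \<longrightarrow> rec_f \<omega> n = 0) \<and>
                  (\<forall>n. n \<notin> {1..N} \<longrightarrow> coef_q \<omega> n = 0) \<and>
                  (\<forall>n\<in>{1..N}. coef_w \<omega> n > 0) \<and> (\<forall>n. n \<notin> {1..N} \<longrightarrow> coef_w \<omega> n = 0)}"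


definition Jmat :: "complex^2^2" where
  "Jmat = vector [vector [0, 1], vector [-1, 0]]"

definition conj_transpose :: "complex^2^2 \<Rightarrow> complex^2^2" where
  "conj_transpose A = map_matrix cnj (transpose A)"

definition block_row :: "complex^2^2 \<Rightarrow> complex^2^2 \<Rightarrow> complex^(2 + 2)^2" where
  "block_row A B = (\<chi> i j. case j of Inl k \<Rightarrow> A $ i $ k | Inr k \<Rightarrow> B $ i $ k)"

type_synonym bc = "((complex^2^2) \<times> (complex^2^2)) set"

definition bc_class :: "complex^2^2 \<Rightarrow> complex^2^2 \<Rightarrow> bc" where
  "bc_class A B = {(T ** A, T ** B) | T :: complex^2^2. invertible T}"

definition BC :: "bc set" where
  "BC = {bc_class A B | A B. rank (block_row A B) = 2 \<and>
           A ** Jmat ** conj_transpose A = B ** Jmat ** conj_transpose B}"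

definition mu1 :: "complex^2^2 \<Rightarrow> complex^2^2 \<Rightarrow> complex" where
  "mu1 A B = A $ 1 $ 1 * B $ 2 $ 2 - A $ 2 $ 1 * B $ 1 $ 2"

definition mu2 :: "complex^2^2 \<Rightarrow> complex^2^2 \<Rightarrow> complex" where
  "mu2 A B = A $ 2 $ 2 * B $ 1 $ 2 - A $ 1 $ 2 * B $ 2 $ 2"

definition Ahat1 :: "real \<Rightarrow> bc" where
  "Ahat1 a = bc_class (vector [vector [complex_of_real a, -1], vector [0, 0]])
                      (vector [vector [0, 0], vector [-1, 0]])"

definition Ahat2 :: "real \<Rightarrow> bc" where
  "Ahat2 a = bc_class (vector [vector [1, complex_of_real a], vector [0, 0]])
                      (vector [vector [0, 0], vector [-1, 0]])"


definition fwd_diff :: "(nat \<Rightarrow> complex) \<Rightarrow> nat \<Rightarrow> complex" where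
  "fwd_diff y n = y (n + 1) - y n"

definition bwd_diff :: "(nat \<Rightarrow> complex) \<Rightarrow> nat \<Rightarrow> complex" where
  "bwd_diff y n = y n - y (n - 1)"

definition quasi_diff :: "sl_eq \<Rightarrow> (nat \<Rightarrow> complex) \<Rightarrow> nat \<Rightarrow> complex" where
  "quasi_diff \<omega> y n = complex_of_real (coef_f \<omega> n) * fwd_diff y n"

text \<open>
  The vectors \<open>(y_0, \<dots>, y_(N+1))\<close> are the sequences vanishing beyond \<open>N + 1\<close>. The boundary
  condition does not depend on the representative of the class.
\<close>

definition solutions :: "nat \<Rightarrow> sl_eq \<Rightarrow> bc \<Rightarrow> complex \<Rightarrow> (nat \<Rightarrow> complex) set" where
  "solutions N \<omega> \<A> z =
     {y. (\<forall>n > N + 1. y n = 0) \<and>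
         (\<forall>n\<in>{1..N}. - bwd_diff (quasi_diff \<omega> y) n + complex_of_real (coef_q \<omega> n) * y n
                        = z * complex_of_real (coef_w \<omega> n) * y n) \<and>
         (\<forall>(A, B)\<in>\<A>. A *v vector [y 0, quasi_diff \<omega> y 0]
                        + B *v vector [y N, quasi_diff \<omega> y N] = 0)}"

definition eigenvalues :: "nat \<Rightarrow> sl_eq \<Rightarrow> bc \<Rightarrow> complex set" where
  "eigenvalues N \<omega> \<A> = {z. \<exists>y \<in> solutions N \<omega> \<A> z. \<exists>n. y n \<noteq> 0}"

definition cseq_scale :: "complex \<Rightarrow> (nat \<Rightarrow> complex) \<Rightarrow> nat \<Rightarrow> complex" where
  "cseq_scale c y = (\<lambda>n. c * y n)"

global_interpretation cseq: vector_space cseq_scale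
  by unfold_locales (auto simp: cseq_scale_def fun_eq_iff algebra_simps)

definition multiplicity_ev :: "nat \<Rightarrow> sl_eq \<Rightarrow> bc \<Rightarrow> complex \<Rightarrow> nat" where
  "multiplicity_ev N \<omega> \<A> z = cseq.dim (solutions N \<omega> \<A> z)"

text \<open>
  The sorted list of all complex eigenvalues, repeated according to multiplicity. Such a list exists
  only if there are finitely many eigenvalues and all of them are real; it is then unique. The
  functions \<open>eig_list\<close> and \<open>eig\<close> are meaningful only under \<open>has_exactly_evs\<close> resp. \<open>eig_defined\<close>.
\<close>

definition is_eig_list :: "nat \<Rightarrow> sl_eq \<Rightarrow> bc \<Rightarrow> real list \<Rightarrow> bool" where
  "is_eig_list N \<omega> \<A> xs \<longleftrightarrow>
     sorted xs \<and> complex_of_real ` set xs = eigenvalues N \<omega> \<A> \<and>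
     (\<forall>x\<in>set xs. count_list xs x = multiplicity_ev N \<omega> \<A> (complex_of_real x))"

lemma is_eig_list_unique:
  assumes "is_eig_list N \<omega> \<A> xs" "is_eig_list N \<omega> \<A> ys"
  shows "xs = ys"
proof -
  have "complex_of_real ` set xs = complex_of_real ` set ys"
    using assms by (simp add: is_eig_list_def)
  then have *: "set xs = set ys"
    by (simp add: inj_image_eq_iff inj_of_real)
  have "count_list xs x = count_list ys x" for x
    using assms * unfolding is_eig_list_def by (cases "x \<in> set xs") (auto simp: count_list_0_iff)
  then have "mset xs = mset ys"
    by (simp add: multiset_eq_iff count_mset)
  then show ?thesis
    using assms unfolding is_eig_list_def by (metis properties_for_sort)
qed

definition has_exactly_evs :: "nat \<Rightarrow> sl_eq \<Rightarrow> bc \<Rightarrow> nat \<Rightarrow> bool" where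
  "has_exactly_evs N \<omega> \<A> k \<longleftrightarrow> (\<exists>xs. is_eig_list N \<omega> \<A> xs \<and> length xs = k)"

definition eig_list :: "nat \<Rightarrow> sl_eq \<Rightarrow> bc \<Rightarrow> real list" where
  "eig_list N \<omega> \<A> = (THE xs. is_eig_list N \<omega> \<A> xs)"

definition eig :: "nat \<Rightarrow> bc \<Rightarrow> nat \<Rightarrow> sl_eq \<Rightarrow> real" where
  "eig N \<A> n \<omega> = eig_list N \<omega> \<A> ! n"

definition eig_defined :: "nat \<Rightarrow> bc \<Rightarrow> nat \<Rightarrow> sl_eq \<Rightarrow> bool" where
  "eig_defined N \<A> n \<omega> \<longleftrightarrow> (\<exists>xs. is_eig_list N \<omega> \<A> xs \<and> n < length xs)"

text \<open>
  Continuity of the partial function \<open>eig N \<A> n\<close>, restricted to \<open>S\<close>, at a point: it has to be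
  defined there, and nearby points count only where it is defined.
\<close>

definition eig_continuous_at :: "nat \<Rightarrow> bc \<Rightarrow> nat \<Rightarrow> sl_eq set \<Rightarrow> sl_eq \<Rightarrow> bool" where
  "eig_continuous_at N \<A> n S \<omega> \<longleftrightarrow>
     eig_defined N \<A> n \<omega> \<and> continuous (at \<omega> within {\<omega>' \<in> S. eig_defined N \<A> n \<omega>'}) (eig N \<A> n)"

definition eig_continuous_on :: "nat \<Rightarrow> bc \<Rightarrow> nat \<Rightarrow> sl_eq set \<Rightarrow> bool" where
  "eig_continuous_on N \<A> n S \<longleftrightarrow> (\<forall>\<omega>\<in>S. eig_continuous_at N \<A> n S \<omega>)"


definition set_rec_f :: "nat \<Rightarrow> sl_eq \<Rightarrow> real \<Rightarrow> sl_eq" where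
  "set_rec_f j \<omega> t = ((rec_f \<omega>)(j := t), coef_q \<omega>, coef_w \<omega>)"

definition set_q :: "nat \<Rightarrow> sl_eq \<Rightarrow> real \<Rightarrow> sl_eq" where
  "set_q j \<omega> t = (rec_f \<omega>, (coef_q \<omega>)(j := t), coef_w \<omega>)"

definition set_w :: "nat \<Rightarrow> sl_eq \<Rightarrow> real \<Rightarrow> sl_eq" where
  "set_w j \<omega> t = (rec_f \<omega>, coef_q \<omega>, (coef_w \<omega>)(j := t))"

definition monotonicity_M :: "nat \<Rightarrow> (sl_eq \<Rightarrow> real) \<Rightarrow> sl_eq set \<Rightarrow> bool" where
  "monotonicity_M N g C \<longleftrightarrow> (\<forall>\<omega>\<in>C.
     (\<forall>j<N. antimono_on {t. set_rec_f j \<omega> t \<in> C} (\<lambda>t. g (set_rec_f j \<omega> t))) \<and>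
     (\<lambda>t. g (set_rec_f N \<omega> t)) constant_on {t. set_rec_f N \<omega> t \<in> C} \<and>
     (\<forall>j\<in>{1..N}. mono_on {t. set_q j \<omega> t \<in> C} (\<lambda>t. g (set_q j \<omega> t))) \<and>
     (\<forall>j\<in>{1..N}. antimono_on {t. set_w j \<omega> t \<in> C} (\<lambda>t. max (g (set_w j \<omega> t)) 0)) \<and>
     (\<forall>j\<in>{1..N}. mono_on {t. set_w j \<omega> t \<in> C} (\<lambda>t. min (g (set_w j \<omega> t)) 0)))"


definition E1 :: "nat \<Rightarrow> real \<Rightarrow> sl_eq set" where
  "E1 N a = {\<omega> \<in> Omega N. rec_f \<omega> 0 = - 1 / a}"

definition E1_plus :: "nat \<Rightarrow> real \<Rightarrow> sl_eq set" where
  "E1_plus N a = {\<omega> \<in> Omega N. rec_f \<omega> 0 > - 1 / a}"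

definition E1_minus :: "nat \<Rightarrow> real \<Rightarrow> sl_eq set" where
  "E1_minus N a = {\<omega> \<in> Omega N. rec_f \<omega> 0 < - 1 / a}"

definition E2 :: "nat \<Rightarrow> real \<Rightarrow> sl_eq set" where
  "E2 N a = {\<omega> \<in> Omega N. rec_f \<omega> 0 = a}"

definition E2_plus :: "nat \<Rightarrow> real \<Rightarrow> sl_eq set" where
  "E2_plus N a = {\<omega> \<in> Omega N. rec_f \<omega> 0 > a}"

definition E2_minus :: "nat \<Rightarrow> real \<Rightarrow> sl_eq set" where
  "E2_minus N a = {\<omega> \<in> Omega N. rec_f \<omega> 0 < a}"

end

theory Submission
  imports Defs "HOL-Computational_Algebra.Fundamental_Theorem_Algebra"
begin

text \<open>
  The condition \<open>\<mu>_1 = \<mu>_2 = 0\<close> forces \<open>y_N = 0\<close> and \<open>(y_0, f_0 \<Delta>y_0) \<in> span (\<alpha>, \<beta>)\<close> with real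
  \<open>(\<alpha>, \<beta>) \<noteq> 0\<close>. Hence the eigenvalues are the zeros of the polynomial \<open>y_N\<close> in the spectral
  parameter, where \<open>y\<close> starts from \<open>(\<alpha>, \<beta>)\<close>. A Wronskian identity for two solutions with different
  spectral parameters and different coefficients shows that these zeros are real and simple. The
  degree is \<open>N - 1\<close>, but \<open>N - 2\<close> where \<open>y_1 = \<alpha> + \<beta>/f_0\<close> vanishes. As the coefficients vary, sign
  changes of \<open>y_N\<close> persist, so near a degenerate point exactly one zero escapes to infinity, and the
  sign of the leading coefficient tells to which end. The same Wronskian identity, applied to two
  nearby eigenfunctions, gives the derivative of an eigenvalue in each coordinate direction.
\<close>

section \<open>The initial value problem\<close>

text \<open>In the coordinates \<open>1/f_j\<close> the recurrence needs no division. So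
  \<open>y_n\<close> and its quasi-difference are polynomials in all coordinates, continuous at
  degenerate points too, and one recurrence over a commutative ring serves for real numbers, complex
  numbers and polynomials.

  The obstacle is that the number of zeros jumps on the hypersurface \<open>y_1 = 0\<close>, so the
  zeros cannot be followed there as a tuple. What is followed instead is the number of zeros below a
  test point \<open>x\<close>. Persisting zeros on both sides of \<open>x\<close> and the bound on
  the degree leave two possible values for it, and the sign of the polynomial at \<open>x\<close>
  fixes its parity. All limits of ordered eigenvalues are translations of such counts; regular
  points are covered by the same argument.

  Continuity comes before differentiability. Once an eigenvalue is known to be continuous along a
  path, the Wronskian identity expresses its difference quotient by quantities whose limits are
  known, so neither the implicit function theorem nor derivatives of eigenfunctions enter.\<close>

fun ysol :: "'a \<Rightarrow> 'a \<Rightarrow> (nat \<Rightarrow> 'a) \<Rightarrow> (nat \<Rightarrow> 'a) \<Rightarrow> nat \<Rightarrow> 'a::comm_ring_1"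
and usol :: "'a \<Rightarrow> 'a \<Rightarrow> (nat \<Rightarrow> 'a) \<Rightarrow> (nat \<Rightarrow> 'a) \<Rightarrow> nat \<Rightarrow> 'a::comm_ring_1" where
  "ysol a b r c 0 = a"
| "ysol a b r c (Suc n) = ysol a b r c n + r n * usol a b r c n"
| "usol a b r c 0 = b"
| "usol a b r c (Suc n) =
     usol a b r c n + c (Suc n) * (ysol a b r c n + r n * usol a b r c n)"

text \<open>The defining equation expands the new value of \<open>ysol\<close> so that the recursion
  descends to index \<open>n\<close>. As a rewrite rule this form replaces it.\<close>

lemma usol_Suc: "usol a b r c (Suc n) = usol a b r c n + c (Suc n) * ysol a b r c (Suc n)"
  by simp

declare usol.simps(2) [simp del]
declare usol_Suc [simp]

text \<open>For \<open>n = N\<close> this is why \<open>1/f_N\<close> has no influence on the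
  eigenvalues. The companion \<open>usol\<close> is controlled only below \<open>n\<close>, since
  its value at \<open>n\<close> already involves \<open>c n\<close>.\<close>

lemma sol_cong:
  assumes "\<And>j. j < n \<Longrightarrow> r j = r' j" "\<And>j. j \<in> {1..<n} \<Longrightarrow> c j = c' j"
  shows "ysol a b r c n = ysol a b r' c' n \<and> (\<forall>m<n. usol a b r c m = usol a b r' c' m)"
  using assms
proof (induction n)
  case (Suc n)
  then have IH: "ysol a b r c n = ysol a b r' c' n" "\<forall>m<n. usol a b r c m = usol a b r' c' m"
    by auto
  have "usol a b r c n = usol a b r' c' n"
  proof (cases n)
    case (Suc m)
    then have "usol a b r c m = usol a b r' c' m" "c n = c' n"
      using IH Suc.prems by auto
    then show ?thesis using IH(1) unfolding Suc usol_Suc by simp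
  qed simp
  then show ?case using IH Suc.prems by (auto simp: less_Suc_eq)
qed simp

text \<open>The recurrence uses only ring operations. The instances needed are
  \<open>of_real\<close>, \<open>cnj\<close> and the evaluation of polynomials.\<close>

lemma sol_hom:
  assumes "\<And>x y. h (x + y) = h x + h y" "\<And>x y. h (x * y) = h x * h y"
  shows "h (ysol a b r c n) = ysol (h a) (h b) (\<lambda>n. h (r n)) (\<lambda>n. h (c n)) n
       \<and> h (usol a b r c n) = usol (h a) (h b) (\<lambda>n. h (r n)) (\<lambda>n. h (c n)) n"
  by (induction n) (simp_all add: assms)

text \<open>Pairing \<open>u\<close> at \<open>n\<close> with \<open>y'\<close> at
  \<open>Suc n\<close> makes each increment split into a pure \<open>r\<close>-term and a pure
  \<open>c\<close>-term. The common initial data leave only \<open>(r' 0 - r 0) * (b * b)\<close> at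
  the start, which is the summand \<open>j = 0\<close>. If both solutions vanish at
  \<open>Suc n\<close>, the two sums cancel each other.\<close>

lemma wronskian:
  fixes a b :: "'a::comm_ring_1" and r c r' c' :: "nat \<Rightarrow> 'a"
  defines "y \<equiv> ysol a b r c" and "u \<equiv> usol a b r c"
    and "y' \<equiv> ysol a b r' c'" and "u' \<equiv> usol a b r' c'"
  shows "u n * y' (Suc n) - y (Suc n) * u' n =
      (\<Sum>j<Suc n. (r' j - r j) * (u j * u' j)) + (\<Sum>j\<in>{1..<Suc n}. (c j - c' j) * (y j * y' j))"
proof (induction n)
  case 0
  then show ?case by (simp add: y_def u_def y'_def u'_def algebra_simps)
next
  case (Suc n)
  have "u (Suc n) * y' (Suc (Suc n)) - y (Suc (Suc n)) * u' (Suc n)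
     = (u n * y' (Suc n) - y (Suc n) * u' n) + (c (Suc n) - c' (Suc n)) * (y (Suc n) * y' (Suc n))
       + (r' (Suc n) - r (Suc n)) * (u (Suc n) * u' (Suc n))"
    unfolding y_def u_def y'_def u'_def
    by (simp only: ysol.simps(2)[of _ _ _ _ "Suc n"] usol_Suc) (simp only: algebra_simps)
  moreover have "(\<Sum>j\<in>{1..<Suc (Suc n)}. g j) = (\<Sum>j\<in>{1..<Suc n}. g j) + g (Suc n)"
    for g :: "nat \<Rightarrow> 'a"
    by (simp add: atLeastLessThanSuc add.commute)
  moreover have "(\<Sum>j<Suc (Suc n). g j) = (\<Sum>j<Suc n. g j) + g (Suc n)" for g :: "nat \<Rightarrow> 'a" by simp
  ultimately show ?case using Suc.IH by (simp only: add_ac)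
qed

text \<open>The solution with \<open>(y_0, f_0 \<Delta>y_0) = (\<alpha>, \<beta>)\<close>, and its quasi-difference \<open>f \<Delta>y\<close>.\<close>

definition ysl :: "real \<Rightarrow> real \<Rightarrow> sl_eq \<Rightarrow> 'a::real_field \<Rightarrow> nat \<Rightarrow> 'a" where
  "ysl \<alpha> \<beta> \<omega> z = ysol (of_real \<alpha>) (of_real \<beta>) (\<lambda>n. of_real (rec_f \<omega> n))
                    (\<lambda>n. of_real (coef_q \<omega> n) - z * of_real (coef_w \<omega> n))"

definition usl :: "real \<Rightarrow> real \<Rightarrow> sl_eq \<Rightarrow> 'a::real_field \<Rightarrow> nat \<Rightarrow> 'a" where
  "usl \<alpha> \<beta> \<omega> z = usol (of_real \<alpha>) (of_real \<beta>) (\<lambda>n. of_real (rec_f \<omega> n))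
                    (\<lambda>n. of_real (coef_q \<omega> n) - z * of_real (coef_w \<omega> n))"

lemma sl_simps [simp]:
  "ysl \<alpha> \<beta> \<omega> z 0 = of_real \<alpha>" "usl \<alpha> \<beta> \<omega> z 0 = of_real \<beta>"
  "ysl \<alpha> \<beta> \<omega> z (Suc n) = ysl \<alpha> \<beta> \<omega> z n + of_real (rec_f \<omega> n) * usl \<alpha> \<beta> \<omega> z n"
  by (simp_all add: ysl_def usl_def)

lemma usl_Suc [simp]: "usl \<alpha> \<beta> \<omega> z (Suc n) = usl \<alpha> \<beta> \<omega> z n
     + (of_real (coef_q \<omega> (Suc n)) - z * of_real (coef_w \<omega> (Suc n))) * ysl \<alpha> \<beta> \<omega> z (Suc n)"
  by (simp add: ysl_def usl_def)

lemma of_real_sl: "of_real (ysl \<alpha> \<beta> \<omega> x n) = ysl \<alpha> \<beta> \<omega> (of_real x) n"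
  unfolding ysl_def by (subst sol_hom[where h = of_real, THEN conjunct1]) simp_all

lemma cnj_sl: "cnj (ysl \<alpha> \<beta> \<omega> z n) = ysl \<alpha> \<beta> \<omega> (cnj z) n"
  unfolding ysl_def using sol_hom[where h = "cnj"] by simp_all

lemma sl_wronskian:
  fixes z z' :: "'a::real_field"
  assumes "n > 0"
  shows "usl \<alpha> \<beta> \<omega> z (n - 1) * ysl \<alpha> \<beta> \<omega>' z' n - ysl \<alpha> \<beta> \<omega> z n * usl \<alpha> \<beta> \<omega>' z' (n - 1) =
      (\<Sum>j<n. of_real (rec_f \<omega>' j - rec_f \<omega> j) * (usl \<alpha> \<beta> \<omega> z j * usl \<alpha> \<beta> \<omega>' z' j))
    + (\<Sum>j\<in>{1..<n}. (of_real (coef_q \<omega> j - coef_q \<omega>' j)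
           - (z * of_real (coef_w \<omega> j) - z' * of_real (coef_w \<omega>' j))) * (ysl \<alpha> \<beta> \<omega> z j
             * ysl \<alpha> \<beta> \<omega>' z' j))"
proof -
  obtain m where m: "n = Suc m" using assms by (cases n) auto
  show ?thesis
    unfolding ysl_def usl_def m diff_Suc_1 wronskian
    by (intro arg_cong2[where f = "(+)"] sum.cong refl) (simp_all add: algebra_simps)
qed

text \<open>For a single equation only the weighted pairing survives. With \<open>z' = cnj z\<close>
  it yields the reality of the zeros; with \<open>z'\<close> as a variable it splits off a linear
  factor and yields their simplicity.\<close>

lemma sl_wronskian_same:
  fixes z z' :: "'a::real_field"
  assumes "n > 0"
  shows "usl \<alpha> \<beta> \<omega> z (n - 1) * ysl \<alpha> \<beta> \<omega> z' n - ysl \<alpha> \<beta> \<omega> z n * usl \<alpha> \<beta> \<omega> z' (n - 1) =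
     (z' - z) * (\<Sum>j\<in>{1..<n}. of_real (coef_w \<omega> j) * (ysl \<alpha> \<beta> \<omega> z j * ysl \<alpha> \<beta> \<omega> z' j))"
  unfolding sl_wronskian[OF assms] by (simp add: sum_distrib_left algebra_simps)

section \<open>Zeros of the characteristic polynomial\<close>

locale sl_bc =
  fixes N :: nat and \<alpha> \<beta> :: real
  assumes N: "N \<ge> 2" and nontrivial: "\<alpha> \<noteq> 0 \<or> \<beta> \<noteq> 0"
begin

abbreviation y :: "sl_eq \<Rightarrow> 'a::real_field \<Rightarrow> nat \<Rightarrow> 'a" where "y \<equiv> ysl \<alpha> \<beta>"
abbreviation u :: "sl_eq \<Rightarrow> 'a::real_field \<Rightarrow> nat \<Rightarrow> 'a" where "u \<equiv> usl \<alpha> \<beta>"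

text \<open>\<open>S \<omega>\<close> is \<open>y_1\<close>; the equation degenerates where it vanishes.\<close>

definition S :: "sl_eq \<Rightarrow> real" where "S \<omega> = \<alpha> + rec_f \<omega> 0 * \<beta>"

definition rootset :: "sl_eq \<Rightarrow> real set" where "rootset \<omega> = {x. y \<omega> x N = 0}"

lemma rec_f_nz: "\<omega> \<in> Omega N \<Longrightarrow> j \<le> N \<Longrightarrow> rec_f \<omega> j \<noteq> 0"
  and coef_w_pos: "\<omega> \<in> Omega N \<Longrightarrow> 1 \<le> j \<Longrightarrow> j \<le> N \<Longrightarrow> coef_w \<omega> j > 0"
  by (auto simp: Omega_def)

text \<open>The weighted sums run over interior indices only, so a nonzero value is needed there.
  Two consecutive zeros force trivial data: \<open>y_1 = y_2 = 0\<close> gives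
  \<open>u_1 = 0\<close>, then \<open>u_0 = 0\<close>, then \<open>y_0 = 0\<close>.\<close>

lemma exists_nonzero:
  fixes z :: "'a::real_field"
  assumes "\<omega> \<in> Omega N" "y \<omega> z N = 0"
  shows "\<exists>j\<in>{1..<N}. y \<omega> z j \<noteq> 0"
proof (rule ccontr)
  assume *: "\<not> ?thesis"
  \<comment> \<open>For \<open>N = 2\<close> the vanishing at index 2 is the assumption on
    \<open>y_N\<close> itself.\<close>
  have "1 \<in> {1..<N}" "N = 2 \<or> 2 \<in> {1..<N}" using N by auto
  then have y1: "y \<omega> z 1 = 0" and y2: "y \<omega> z 2 = 0" using * assms(2) by blast+
  have "rec_f \<omega> 0 \<noteq> 0" "rec_f \<omega> 1 \<noteq> 0" using rec_f_nz[OF assms(1)] N by auto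
  moreover have "usl \<alpha> \<beta> \<omega> z 1 = 0"
    using y1 y2 \<open>rec_f \<omega> 1 \<noteq> 0\<close> sl_simps(3)[of \<alpha> \<beta> \<omega> z 1]
      by (simp del: sl_simps add: numeral_2_eq_2)
  then have "usl \<alpha> \<beta> \<omega> z 0 = 0" using y1 usl_Suc[of \<alpha> \<beta> \<omega> z 0] by (simp del: sl_simps)
  ultimately show False using y1 sl_simps(3)[of \<alpha> \<beta> \<omega> z 0] nontrivial by simp
qed

lemma weight_pos:
  assumes "\<omega> \<in> Omega N" "y \<omega> x N = 0"
  shows "(\<Sum>j\<in>{1..<N}. coef_w \<omega> j * (y \<omega> (x::real) j)\<^sup>2) > 0"
proof -
  obtain j where "j \<in> {1..<N}" "y \<omega> x j \<noteq> 0" using exists_nonzero[OF assms] by auto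
  then show ?thesis
    by (intro sum_pos2[where i = j]) (auto intro!: mult_pos_pos mult_nonneg_nonneg coef_w_pos[OF
      assms(1)]
      less_imp_le[OF coef_w_pos[OF assms(1)]])
qed

text \<open>Conjugate parameters give conjugate solutions, so the pairing in the Wronskian identity
  becomes a weighted square norm, which is positive.\<close>

lemma roots_real:
  fixes z :: complex
  assumes \<omega>: "\<omega> \<in> Omega N" and z: "y \<omega> z N = 0"
  shows "z \<in> \<real>"
proof -
  have z': "y \<omega> (cnj z) N = 0" using z cnj_sl[of \<alpha> \<beta> \<omega> z N] by simp
  have "(cnj z - z) * (\<Sum>j\<in>{1..<N}. of_real (coef_w \<omega> j) * (y \<omega> z j * y \<omega> (cnj z) j)) = 0"
    using sl_wronskian_same[of N \<alpha> \<beta> \<omega> z "cnj z"] z z' N by simp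
  also have "(\<Sum>j\<in>{1..<N}. of_real (coef_w \<omega> j) * (y \<omega> z j * y \<omega> (cnj z) j))
     = of_real (\<Sum>j\<in>{1..<N}. coef_w \<omega> j * (cmod (y \<omega> z j))\<^sup>2)"
    by (simp add: cnj_sl[symmetric] complex_norm_square del: of_real_power)
  finally have *: "cnj z = z \<or> (\<Sum>j\<in>{1..<N}. coef_w \<omega> j * (cmod (y \<omega> z j))\<^sup>2) = 0"
    by (simp del: of_real_sum of_real_mult)
  obtain j where "j \<in> {1..<N}" "y \<omega> z j \<noteq> 0" using exists_nonzero[OF assms] by auto
  then have "(\<Sum>j\<in>{1..<N}. coef_w \<omega> j * (cmod (y \<omega> z j))\<^sup>2) > 0"
    by (intro sum_pos2[where i = j]) (auto intro!: mult_pos_pos mult_nonneg_nonneg coef_w_pos[OF \<omega>]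
      less_imp_le[OF coef_w_pos[OF \<omega>]])
  with * show ?thesis by (simp add: Reals_cnj_iff)
qed

section \<open>Degree, simplicity of roots and factorization of the characteristic
  polynomial\<close>

definition ypoly :: "sl_eq \<Rightarrow> nat \<Rightarrow> complex poly" where
  "ypoly \<omega> = ysol [:of_real \<alpha>:] [:of_real \<beta>:] (\<lambda>n. [:of_real (rec_f \<omega> n):])
               (\<lambda>n. [:of_real (coef_q \<omega> n), - of_real (coef_w \<omega> n):])"

definition upoly :: "sl_eq \<Rightarrow> nat \<Rightarrow> complex poly" where
  "upoly \<omega> = usol [:of_real \<alpha>:] [:of_real \<beta>:] (\<lambda>n. [:of_real (rec_f \<omega> n):])
               (\<lambda>n. [:of_real (coef_q \<omega> n), - of_real (coef_w \<omega> n):])"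

lemma poly_ypoly: "poly (ypoly \<omega> n) z = y \<omega> z n"
  unfolding ypoly_def ysl_def using sol_hom[where h = "\<lambda>p. poly p z"] by simp

lemma ypoly_Suc: "ypoly \<omega> (Suc n) = ypoly \<omega> n + smult (of_real (rec_f \<omega> n)) (upoly \<omega> n)"
  and upoly_Suc: "upoly \<omega> (Suc n) = upoly \<omega> n +
      [:of_real (coef_q \<omega> (Suc n)), - of_real (coef_w \<omega> (Suc n)):] * ypoly \<omega> (Suc n)"
  unfolding ypoly_def upoly_def ysol.simps usol_Suc by simp_all

text \<open>With one parameter fixed at a root \<open>z\<close> and the other free, the Wronskian
  identity says that a multiple of \<open>ypoly \<omega> N\<close> is \<open>[:-z, 1:] * q\<close>.
  At a double root the derivative of this product at \<open>z\<close>, which is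
  \<open>poly q z\<close>, would vanish; but it is the weighted square norm of the
  eigenfunction.\<close>

lemma simple_roots:
  assumes \<omega>: "\<omega> \<in> Omega N"
  shows "rsquarefree (ypoly \<omega> N)"
  unfolding rsquarefree_roots
proof (intro allI notI)
  fix z assume *: "poly (ypoly \<omega> N) z = 0 \<and> poly (pderiv (ypoly \<omega> N)) z = 0"
  then have z: "y \<omega> z N = 0" by (simp add: poly_ypoly)
  then obtain x where x: "z = of_real x" using roots_real[OF \<omega>] by (auto elim: Reals_cases)
  define q where "q = (\<Sum>j\<in>{1..<N}. smult (of_real (coef_w \<omega> j) * y \<omega> z j) (ypoly \<omega> j))"
  have "smult (u \<omega> z (N - 1)) (ypoly \<omega> N) = [:-z, 1:] * q"
  proof (rule poly_eq_poly_eq_iff[THEN iffD1], rule ext)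
    fix t
    show "poly (smult (u \<omega> z (N - 1)) (ypoly \<omega> N)) t = poly ([:-z, 1:] * q) t"
      using sl_wronskian_same[of N \<alpha> \<beta> \<omega> z t] z N
      by (simp add: poly_ypoly q_def poly_sum mult.assoc algebra_simps)
  qed
  then have "poly (pderiv (smult (u \<omega> z (N - 1)) (ypoly \<omega> N))) z = poly (pderiv ([:-z, 1:] * q)) z"
    by simp
  moreover have "poly (pderiv (smult (u \<omega> z (N - 1)) (ypoly \<omega> N))) z = 0"
    using * by (simp add: pderiv_smult)
  moreover have "poly (pderiv ([:-z, 1:] * q)) z = poly q z"
    by (simp only: pderiv_mult) (simp add: pderiv_pCons)
  ultimately have "poly q z = 0" by simp
  moreover have "poly q z = of_real (\<Sum>j\<in>{1..<N}. coef_w \<omega> j * (y \<omega> x j)\<^sup>2)"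
    by (simp add: q_def poly_sum poly_ypoly x of_real_sl power2_eq_square mult.assoc)
  moreover have "y \<omega> x N = 0" using z x of_real_sl[of \<alpha> \<beta> \<omega> x N, where 'a = complex] 
    by simp
  ultimately show False using weight_pos[OF \<omega>, of x] by (metis less_irrefl of_real_eq_0_iff)
qed

text \<open>From a constant \<open>y\<close> onwards, each step multiplies the top coefficient by
  \<open>- r_j w_j\<close>. The start is left variable: \<open>m = 0\<close> is the regular case,
  and \<open>m = 1\<close> the degenerate one, where \<open>y_1 = 0\<close> and \<open>y_2\<close>
  is the constant \<open>r_1 \<beta>\<close>, so that one degree is lost. Only a degree bound is
  carried along, because \<open>a\<close> may be zero here.\<close>

lemma poly_growth:
  assumes "ypoly \<omega> (Suc m) = [:of_real a:]" "degree (upoly \<omega> m) = 0"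
  shows "degree (ypoly \<omega> (Suc m + n)) \<le> n \<and>
    coeff (ypoly \<omega> (Suc m + n)) n = of_real (a * ((-1) ^ n * (\<Prod>j\<in>{Suc m..m+n}. rec_f \<omega> j
      * coef_w \<omega> j))) \<and>
    degree (upoly \<omega> (m + n)) \<le> n"
proof (induction n)
  case 0
  then show ?case using assms by simp
next
  case (Suc n)
  let ?k = "Suc m + n"
  have u: "degree (upoly \<omega> ?k) \<le> Suc n" "coeff (upoly \<omega> ?k) (Suc n) = - of_real (coef_w \<omega> ?k)
    * coeff (ypoly \<omega> ?k) n"
  proof -
    have "degree ([:of_real (coef_q \<omega> ?k), - of_real (coef_w \<omega> ?k):] * ypoly \<omega> ?k) \<le> Suc n"
      using Suc degree_mult_le[of "[:of_real (coef_q \<omega> ?k), - of_real (coef_w \<omega> ?k):]" "ypoly \<omega> ?k"]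
      by (auto split: if_splits)
    then show "degree (upoly \<omega> ?k) \<le> Suc n"
      using Suc upoly_Suc[of \<omega> "m + n"] by (simp add: degree_add_le)
    have "coeff (ypoly \<omega> ?k) (Suc n) = 0" "coeff (upoly \<omega> (m + n)) (Suc n) = 0"
      using Suc by (auto intro!: coeff_eq_0)
    then show "coeff (upoly \<omega> ?k) (Suc n) = - of_real (coef_w \<omega> ?k) * coeff (ypoly \<omega> ?k) n"
      using upoly_Suc[of \<omega> "m + n"] by (simp add: mult_pCons_left coeff_pCons)
  qed
  have "coeff (ypoly \<omega> ?k) (Suc n) = 0" using Suc by (auto intro!: coeff_eq_0)
  then show ?case using Suc u ypoly_Suc[of \<omega> ?k]
    by (auto simp: prod.atLeast_Suc_atMost_Suc_shift intro!: degree_add_le degree_smult_le[THEN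
      order_trans])
qed

text \<open>\<open>lead \<omega>\<close> has the sign of \<open>y \<omega> x N\<close> near \<open>x = -\<infinity>\<close>.\<close>

definition lead :: "sl_eq \<Rightarrow> real" where
  "lead \<omega> = (if S \<omega> = 0 then \<beta> * rec_f \<omega> 1 * (\<Prod>j\<in>{2..<N}. rec_f \<omega> j * coef_w \<omega> j)
            else S \<omega> * (\<Prod>j\<in>{1..<N}. rec_f \<omega> j * coef_w \<omega> j))"

definition num_eigs :: "sl_eq \<Rightarrow> nat" where "num_eigs \<omega> = (if S \<omega> = 0 then N - 2 else N - 1)"

lemma S_zero_imp: "\<omega> \<in> Omega N \<Longrightarrow> S \<omega> = 0 \<Longrightarrow> \<beta> \<noteq> 0"
  using nontrivial by (auto simp: S_def)

lemma lead_nz: "\<omega> \<in> Omega N \<Longrightarrow> lead \<omega> \<noteq> 0"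
  using rec_f_nz[of \<omega>] coef_w_pos[of \<omega>] S_zero_imp[of \<omega>] N unfolding lead_def
  by (auto simp: less_le)

lemma ypoly_lead:
  assumes \<omega>: "\<omega> \<in> Omega N"
  shows "degree (ypoly \<omega> N) = num_eigs \<omega>" "lead_coeff (ypoly \<omega> N) = of_real ((-1) ^ num_eigs \<omega>
    * lead \<omega>)"
proof -
  have y1: "ypoly \<omega> (Suc 0) = [:of_real (S \<omega>):]" and u0: "degree (upoly \<omega> 0) = 0"
    by (simp_all add: ypoly_def upoly_def S_def)
  have *: "degree (ypoly \<omega> N) \<le> num_eigs \<omega> \<and> coeff (ypoly \<omega> N) (num_eigs \<omega>)
    = of_real ((-1) ^ num_eigs \<omega> * lead \<omega>)"
  proof (cases "S \<omega> = 0")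
    case False
    have "{Suc 0..N - 1} = {1..<N}" using N by auto
    then show ?thesis using poly_growth[OF y1 u0, of "N - 1"] N False
      by (simp add: num_eigs_def lead_def mult_ac)
  next
    case True
    have u1: "upoly \<omega> (Suc 0) = [:of_real \<beta>:]"
      unfolding upoly_Suc y1 True by (simp add: upoly_def)
    have y2: "ypoly \<omega> (Suc (Suc 0)) = [:of_real (rec_f \<omega> 1 * \<beta>):]"
      using ypoly_Suc[of \<omega> "Suc 0"] u1 y1 True by simp
    have "{Suc (Suc 0)..Suc 0 + (N - 2)} = {2..<N}" using N by auto
    moreover have "Suc (Suc 0) + (N - 2) = N" using N by simp
    ultimately show ?thesis using poly_growth[OF y2, of "N - 2"] u1 True
      by (simp add: num_eigs_def lead_def mult_ac)
  qed
  then have "coeff (ypoly \<omega> N) (num_eigs \<omega>) \<noteq> 0" using lead_nz[OF \<omega>] by simp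
  with * show "degree (ypoly \<omega> N) = num_eigs \<omega>" using le_degree by (metis le_antisym)
  with * show "lead_coeff (ypoly \<omega> N) = of_real ((-1) ^ num_eigs \<omega> * lead \<omega>)" by simp
qed

lemma complex_roots:
  assumes "\<omega> \<in> Omega N"
  shows "{z::complex. y \<omega> z N = 0} = of_real ` rootset \<omega>"
proof -
  have "(y \<omega> (of_real x :: complex) N = 0) = (y \<omega> x N = 0)" for x
    by (metis of_real_eq_0_iff of_real_sl)
  then show ?thesis using roots_real[OF assms] unfolding rootset_def
    by (auto simp: image_iff) (metis Reals_cases)
qed

text \<open>The polynomial splits over the complex numbers, and since its roots are simple and real,
  their number is the degree. With factors \<open>\<rho> - x\<close> the product is positive to the
  left of all zeros, and its sign elsewhere counts the zeros below \<open>x\<close> modulo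
  2.\<close>

lemma y_factorization:
  assumes \<omega>: "\<omega> \<in> Omega N"
  shows "finite (rootset \<omega>)" "card (rootset \<omega>) = num_eigs \<omega>"
    "y \<omega> x N = lead \<omega> * (\<Prod>\<rho>\<in>rootset \<omega>. \<rho> - x)"
proof -
  let ?p = "ypoly \<omega> N"
  have p0: "?p \<noteq> 0" using ypoly_lead(2)[OF \<omega>] lead_nz[OF \<omega>] by auto
  have roots: "{z. poly ?p z = 0} = of_real ` rootset \<omega>"
    using complex_roots[OF \<omega>] by (simp add: poly_ypoly)
  then show fin: "finite (rootset \<omega>)"
    by (metis finite_imageD inj_of_real inj_on_subset poly_roots_finite[OF p0] subset_UNIV)
  have fact: "?p = smult (lead_coeff ?p) (\<Prod>\<rho>\<in>rootset \<omega>. [:- of_real \<rho>, 1:])"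
    using complex_poly_decompose_rsquarefree[OF simple_roots[OF \<omega>]] unfolding roots
    by (simp add: prod.reindex inj_on_def)
  have "degree ?p = card (rootset \<omega>)"
    using p0 by (subst fact) (simp add: degree_prod_eq_sum_degree)
  then show c: "card (rootset \<omega>) = num_eigs \<omega>" using ypoly_lead(1)[OF \<omega>] by simp
  have "of_real (y \<omega> x N) = poly ?p (of_real x)"
    by (simp add: of_real_sl poly_ypoly)
  also have "\<dots> = of_real ((-1) ^ num_eigs \<omega> * lead \<omega>) * (\<Prod>\<rho>\<in>rootset \<omega>. of_real x - of_real \<rho>)"
    by (subst fact) (simp add: poly_prod ypoly_lead(2)[OF \<omega>])
  also have "\<dots> = of_real ((-1) ^ num_eigs \<omega> * lead \<omega> * (\<Prod>\<rho>\<in>rootset \<omega>. x - \<rho>))" by simp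
  finally have "y \<omega> x N = (-1) ^ num_eigs \<omega> * lead \<omega> * (\<Prod>\<rho>\<in>rootset \<omega>. x - \<rho>)"
    by (simp only: of_real_eq_iff)
  also have "(\<Prod>\<rho>\<in>rootset \<omega>. x - \<rho>) = (\<Prod>\<rho>\<in>rootset \<omega>. (-1) * (\<rho> - x))" by simp
  also have "\<dots> = (-1) ^ num_eigs \<omega> * (\<Prod>\<rho>\<in>rootset \<omega>. \<rho> - x)"
    by (simp only: prod.distrib prod_constant c)
  finally show "y \<omega> x N = lead \<omega> * (\<Prod>\<rho>\<in>rootset \<omega>. \<rho> - x)"
    by (simp add: power_mult_distrib[symmetric] mult.assoc[symmetric] mult.commute[of _ "lead \<omega>"])
qed

end

section \<open>Zeros under perturbation\<close>

lemma eventually_sgn_eq: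
  fixes f :: "'i \<Rightarrow> real"
  assumes "(f \<longlongrightarrow> l) G" "l \<noteq> 0"
  shows "\<forall>\<^sub>F i in G. sgn (f i) = sgn l"
proof (cases "l > 0")
  case True
  then have "\<forall>\<^sub>F i in G. f i > 0" by (rule order_tendstoD(1)[OF assms(1)])
  then show ?thesis using True by (auto elim!: eventually_mono)
next
  case False
  then have "l < 0" using assms(2) by simp
  then have "\<forall>\<^sub>F i in G. f i < 0" by (rule order_tendstoD(2)[OF assms(1)])
  then show ?thesis using \<open>l < 0\<close> by (auto elim!: eventually_mono)
qed

lemma sgn_prod_diff:
  fixes x :: real
  assumes "finite R" "x \<notin> R"
  shows "sgn (\<Prod>\<rho>\<in>R. \<rho> - x) = (-1) ^ card {\<rho>\<in>R. \<rho> < x}"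
  using assms
proof (induction R)
  case (insert \<rho> R)
  have "{\<sigma> \<in> insert \<rho> R. \<sigma> < x} = (if \<rho> < x then insert \<rho> {\<sigma>\<in>R. \<sigma> < x} else {\<sigma>\<in>R. \<sigma> < x})"
    by auto
  moreover have "sgn (\<rho> - x) = (if \<rho> < x then -1 else 1)" using insert.prems by auto
  moreover have "\<rho> \<notin> {\<sigma>\<in>R. \<sigma> < x}" using insert.hyps by auto
  ultimately show ?case using insert by (simp add: sgn_mult)
qed simp

lemma sgn_prod_eq_zeroD:
  fixes K :: real
  assumes "finite R" "K \<noteq> 0" "K * (\<Prod>\<rho>\<in>R. \<rho> - x) = 0"
  shows "x \<in> R"
  using assms by auto

text \<open>Sign changes keep at least as many zeros on either side of \<open>x\<close>; since there is at most one
  extra zero, the sign at \<open>x\<close> decides on which side it lies.\<close>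

lemma eventually_count_less:
  fixes F :: "'i \<Rightarrow> real \<Rightarrow> real"
  assumes fin0: "finite R0" and F0: "\<And>x. F0 x = K0 * (\<Prod>\<rho>\<in>R0. \<rho> - x)" and K0: "K0 \<noteq> 0"
    and ev: "\<forall>\<^sub>F i in G. finite (R i) \<and> (\<forall>x. F i x = K i * (\<Prod>\<rho>\<in>R i. \<rho> - x)) \<and>
               card (R i) \<le> Suc (card R0) \<and> sgn (K i) = (-1) ^ e * sgn K0"
    and lim: "\<And>x. ((\<lambda>i. F i x) \<longlongrightarrow> F0 x) G"
    and e: "e \<le> 1" and x: "x \<notin> R0"
  shows "\<forall>\<^sub>F i in G. card {\<rho>\<in>R i. \<rho> < x} = card {\<rho>\<in>R0. \<rho> < x} + e"
proof -
  have eventually_less: "\<forall>\<^sub>F \<epsilon> in at_right (0::real). \<epsilon> < c" if "c > 0" for c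
    using that by (auto simp: eventually_at_right)
  then have small: "\<forall>\<^sub>F \<epsilon> in at_right (0::real). 2 * \<epsilon> < c" if "c > 0" for c
    using that by (intro eventually_mono[OF eventually_less[of "c/2"]]) auto
  have "\<forall>\<^sub>F \<epsilon> in at_right 0. \<forall>\<rho>\<in>R0. (\<forall>\<sigma>\<in>R0. \<rho> \<noteq> \<sigma> \<longrightarrow> 2 * \<epsilon> < \<bar>\<rho> - \<sigma>\<bar>) \<and> 2 * \<epsilon> < \<bar>\<rho> - x\<bar>"
    using x fin0 by (auto intro!: eventually_ball_finite eventually_conj small)
  moreover have "\<forall>\<^sub>F \<epsilon> in at_right (0::real). 0 < \<epsilon>" by (simp add: eventually_at_right_less)
  ultimately have "\<forall>\<^sub>F \<epsilon> in at_right 0. 0 < \<epsilon> \<and> (\<forall>\<rho>\<in>R0. (\<forall>\<sigma>\<in>R0. \<rho> \<noteq> \<sigma> \<longrightarrow> 2 * \<epsilon> < \<bar>\<rho> - \<sigma>\<bar>)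
    \<and> 2 * \<epsilon> < \<bar>\<rho> - x\<bar>)"
    by (rule eventually_elim2) auto
  then have "\<exists>\<epsilon>>0. \<forall>\<rho>\<in>R0. (\<forall>\<sigma>\<in>R0. \<rho> \<noteq> \<sigma> \<longrightarrow> 2 * \<epsilon> < \<bar>\<rho> - \<sigma>\<bar>) \<and> 2 * \<epsilon> < \<bar>\<rho> - x\<bar>"
    by (rule eventually_happens'[OF trivial_limit_at_right_real])
  \<comment> \<open>The factor 2 makes the closed \<open>\<epsilon>\<close>-intervals around the
    points of \<open>R0\<close> pairwise disjoint, and none of them contains
    \<open>x\<close>.\<close>
  then obtain \<epsilon> where \<epsilon>: "\<epsilon> > 0" and sep: "\<And>\<rho> \<sigma>. \<rho> \<in> R0 \<Longrightarrow> \<sigma> \<in> R0 \<Longrightarrow> \<rho> \<noteq> \<sigma> \<Longrightarrow> 2 * \<epsilon> < \<bar>\<rho> - \<sigma>\<bar>"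
    and sepx: "\<And>\<rho>. \<rho> \<in> R0 \<Longrightarrow> 2 * \<epsilon> < \<bar>\<rho> - x\<bar>"
    by auto
  have notin: "\<rho> - \<epsilon> \<notin> R0" "\<rho> + \<epsilon> \<notin> R0" if "\<rho> \<in> R0" for \<rho>
    using sep[OF that, of "\<rho> - \<epsilon>"] sep[OF that, of "\<rho> + \<epsilon>"] \<epsilon> by auto
  have sgnF0: "sgn (F0 z) = sgn K0 * (-1) ^ card {\<rho>\<in>R0. \<rho> < z}" if "z \<notin> R0" for z
    using sgn_prod_diff[OF fin0 that] by (simp add: F0 sgn_mult)
  have nz: "F0 z \<noteq> 0" if "z \<notin> R0" for z using sgn_prod_eq_zeroD[OF fin0 K0] that by (metis F0)
  have change: "sgn (F0 (\<rho> + \<epsilon>)) = - sgn (F0 (\<rho> - \<epsilon>))" if \<rho>: "\<rho> \<in> R0" for \<rho>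
  proof -
    have "{\<sigma>\<in>R0. \<sigma> < \<rho> + \<epsilon>} = insert \<rho> {\<sigma>\<in>R0. \<sigma> < \<rho> - \<epsilon>}"
    proof -
      have "\<sigma> < \<rho> + \<epsilon> \<longleftrightarrow> \<sigma> < \<rho> - \<epsilon>" if "\<sigma> \<in> R0" "\<sigma> \<noteq> \<rho>" for \<sigma>
        using sep[OF \<rho> that(1)] that(2) \<epsilon> by arith
      then show ?thesis using \<rho> \<epsilon> by auto
    qed
    then have "card {\<sigma>\<in>R0. \<sigma> < \<rho> + \<epsilon>} = Suc (card {\<sigma>\<in>R0. \<sigma> < \<rho> - \<epsilon>})"
      using fin0 \<epsilon> by simp
    then show ?thesis using notin[OF \<rho>] by (simp add: sgnF0)
  qed
  have "\<forall>\<^sub>F i in G. \<forall>\<rho>\<in>R0. sgn (F i (\<rho> - \<epsilon>)) = sgn (F0 (\<rho> - \<epsilon>)) \<and> sgn (F i (\<rho> + \<epsilon>))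
    = sgn (F0 (\<rho> + \<epsilon>))"
    using fin0 notin nz by (auto intro!: eventually_ball_finite eventually_conj eventually_sgn_eq
      lim)
  moreover have "\<forall>\<^sub>F i in G. sgn (F i x) = sgn (F0 x)" using x nz
    by (intro eventually_sgn_eq lim) auto
  ultimately show ?thesis using ev
  proof eventually_elim
    case (elim i)
    have fin: "finite (R i)" and Fi: "\<And>x. F i x = K i * (\<Prod>\<rho>\<in>R i. \<rho> - x)" and Ki: "K i \<noteq> 0"
      using elim(3) K0 by (auto simp: sgn_if split: if_splits)
    \<comment> \<open>The sign change around \<open>\<rho>\<close> survives the perturbation. The
      zeros found near different points of \<open>R0\<close> are distinct, and each lies on the same
      side of \<open>x\<close> as its \<open>\<rho>\<close>.\<close>
    have "\<exists>z. z \<in> R i \<and> \<bar>z - \<rho>\<bar> \<le> \<epsilon>" if \<rho>: "\<rho> \<in> R0" for \<rho>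
    proof -
      have cont: "isCont (F i) z" for z by (subst Fi[abs_def]) (intro continuous_intros)
      have "sgn (F i (\<rho> + \<epsilon>)) = - sgn (F i (\<rho> - \<epsilon>))" using elim(1) change \<rho> by simp
      then have "(F i (\<rho> - \<epsilon>) \<le> 0 \<and> 0 \<le> F i (\<rho> + \<epsilon>)) \<or> (F i (\<rho> + \<epsilon>) \<le> 0 \<and> 0 \<le> F i (\<rho> - \<epsilon>))"
        by (auto simp: sgn_if split: if_splits)
      then obtain z where "\<rho> - \<epsilon> \<le> z" "z \<le> \<rho> + \<epsilon>" "F i z = 0"
        using IVT[of "F i" "\<rho> - \<epsilon>" 0 "\<rho> + \<epsilon>"] IVT2[of "F i" "\<rho> + \<epsilon>" 0 "\<rho> - \<epsilon>"] cont \<epsilon> by auto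
      then show ?thesis using sgn_prod_eq_zeroD[OF fin Ki] by (auto simp: Fi intro!: exI[of _ z])
    qed
    then obtain g where g: "\<And>\<rho>. \<rho> \<in> R0 \<Longrightarrow> g \<rho> \<in> R i" "\<And>\<rho>. \<rho> \<in> R0 \<Longrightarrow> \<bar>g \<rho> - \<rho>\<bar> \<le> \<epsilon>"
      by metis
    have inj: "inj_on g A" if "A \<subseteq> R0" for A
    proof (rule inj_onI, rule ccontr)
      fix \<rho> \<sigma> assume "\<rho> \<in> A" "\<sigma> \<in> A" "g \<rho> = g \<sigma>" "\<rho> \<noteq> \<sigma>"
      then have "2 * \<epsilon> < \<bar>\<rho> - \<sigma>\<bar>" "\<bar>g \<rho> - \<rho>\<bar> \<le> \<epsilon>" "\<bar>g \<rho> - \<sigma>\<bar> \<le> \<epsilon>"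
        using sep[of \<rho> \<sigma>] g(2)[of \<rho>] g(2)[of \<sigma>] that by auto
      then show False by arith
    qed
    have side: "g \<rho> < x \<longleftrightarrow> \<rho> < x" "x < g \<rho> \<longleftrightarrow> x < \<rho>" if "\<rho> \<in> R0" for \<rho>
      using sepx[OF that] g(2)[OF that] \<epsilon> by arith+
    have less: "card {\<rho>\<in>R0. \<rho> < x} \<le> card {\<rho>\<in>R i. \<rho> < x}"
      using side g(1) fin by (intro card_inj_on_le[where f = g] inj) auto
    have greater: "card {\<rho>\<in>R0. \<rho> > x} \<le> card {\<rho>\<in>R i. \<rho> > x}"
      using side g(1) fin by (intro card_inj_on_le[where f = g] inj) auto
    have sx: "sgn (F i x) = sgn (F0 x)" by fact
    then have xi: "x \<notin> R i" using nz[OF x] Fi[of x] fin by (auto simp: sgn_if split: if_splits)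
    have split: "card A = card {\<rho>\<in>A. \<rho> < x} + card {\<rho>\<in>A. \<rho> > x}" if "finite A" "x \<notin> A" for A
    proof -
      have "\<rho> < x \<or> \<rho> > x" if "\<rho> \<in> A" for \<rho> using that \<open>x \<notin> A\<close> by (metis linorder_neqE)
      then have "A = {\<rho>\<in>A. \<rho> < x} \<union> {\<rho>\<in>A. \<rho> > x}" by blast
      then have "card A = card ({\<rho>\<in>A. \<rho> < x} \<union> {\<rho>\<in>A. \<rho> > x})" by simp
      also have "\<dots> = card {\<rho>\<in>A. \<rho> < x} + card {\<rho>\<in>A. \<rho> > x}"
        using that by (intro card_Un_disjoint) auto
      finally show ?thesis .
    qed
    \<comment> \<open>The persisting zeros on both sides, together with at most one new zero, leave
      for the count below \<open>x\<close> only the old value and its successor. Comparing signs at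
      \<open>x\<close> gives the parity, which selects the old value plus \<open>e\<close>.\<close>
    have "sgn (K i) * (-1) ^ card {\<rho>\<in>R i. \<rho> < x} = sgn K0 * (-1) ^ card {\<rho>\<in>R0. \<rho> < x}"
      using sx sgn_prod_diff[OF fin xi] sgnF0[OF x] by (simp add: Fi sgn_mult)
    then have "sgn K0 * (-1) ^ (e + card {\<rho>\<in>R i. \<rho> < x}) = sgn K0 * (-1) ^ card {\<rho>\<in>R0. \<rho> < x}"
      using elim(3) by (simp add: power_add mult_ac)
    then have "even (e + card {\<rho>\<in>R i. \<rho> < x}) = even (card {\<rho>\<in>R0. \<rho> < x})"
      using K0 by (auto simp: minus_one_power_iff sgn_if split: if_splits)
    moreover have "card {\<rho>\<in>R i. \<rho> < x} \<le> Suc (card {\<rho>\<in>R0. \<rho> < x})"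
      using split[OF fin xi] split[OF fin0 x] greater elim(3) by linarith
    ultimately show ?case using less e by presburger
  qed
qed

text \<open>This is the bridge from counting to ordering: upper and lower bounds on an ordered zero
  become statements about the number of zeros below a test point.\<close>

lemma sorted_list_nth_less_iff:
  fixes x :: "'a::linorder"
  assumes "finite R" "n < card R"
  shows "sorted_list_of_set R ! n < x \<longleftrightarrow> n < card {\<rho>\<in>R. \<rho> < x}"
proof -
  let ?xs = "sorted_list_of_set R"
  have len: "length ?xs = card R" and set: "set ?xs
    = R" and dist: "distinct ?xs" and sorted: "sorted ?xs"
    using assms by auto
  have inj: "inj_on ((!) ?xs) {..<card R}" using dist len by (auto intro: inj_on_nth)
  show ?thesis
  proof
    assume *: "?xs ! n < x"
    have "(!) ?xs ` {..n} \<subseteq> {\<rho>\<in>R. \<rho> < x}"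
    proof
      fix \<rho> assume "\<rho> \<in> (!) ?xs ` {..n}"
      then obtain k where k: "k \<le> n" "\<rho> = ?xs ! k" by auto
      then have "\<rho> \<le> ?xs ! n" using sorted assms len by (auto intro: sorted_nth_mono)
      moreover have "\<rho> \<in> R" using k assms(2) len set by (metis nth_mem order_le_less_trans)
      ultimately show "\<rho> \<in> {\<rho>\<in>R. \<rho> < x}" using * by auto
    qed
    then have "card ((!) ?xs ` {..n}) \<le> card {\<rho>\<in>R. \<rho> < x}" using assms by (intro card_mono) auto
    moreover have "card ((!) ?xs ` {..n}) = Suc n"
      using assms by (subst card_image) (auto intro: inj_on_subset[OF inj])
    ultimately show "n < card {\<rho>\<in>R. \<rho> < x}" by simp
  next
    assume *: "n < card {\<rho>\<in>R. \<rho> < x}"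
    show "?xs ! n < x"
    proof (rule ccontr)
      assume ge: "\<not> ?thesis"
      have "{\<rho>\<in>R. \<rho> < x} \<subseteq> (!) ?xs ` {..<n}"
      proof
        fix \<rho> assume \<rho>: "\<rho> \<in> {\<rho>\<in>R. \<rho> < x}"
        then obtain k where k: "k < card R" "\<rho> = ?xs ! k" using set len
          by (metis (no_types, lifting) in_set_conv_nth mem_Collect_eq)
        have "k < n"
        proof (rule ccontr)
          assume "\<not> k < n"
          then have "?xs ! n \<le> ?xs ! k" using sorted k len by (auto intro: sorted_nth_mono)
          then show False using ge \<rho> k by auto
        qed
        then show "\<rho> \<in> (!) ?xs ` {..<n}" using k by auto
      qed
      then have "card {\<rho>\<in>R. \<rho> < x} \<le> card ((!) ?xs ` {..<n})" by (intro card_mono) auto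
      also have "\<dots> \<le> n" using card_image_le[of "{..<n}" "(!) ?xs"] by simp
      finally show False using * by simp
    qed
  qed
qed

lemma exists_between_notin:
  fixes a b :: real
  assumes "finite R" "a < b"
  shows "\<exists>x. a < x \<and> x < b \<and> x \<notin> R"
  using assms infinite_Ioo[of a b] by (metis finite_subset greaterThanLessThan_iff subsetI)

text \<open>Test points just below and just above the limit enclose the ordered zero, by the counts
  at these points. With \<open>e = 1\<close> a zero has come in from minus infinity and every old
  zero moves up by one index.\<close>

lemma tendsto_sorted_list_nth:
  fixes R0 :: "real set"
  assumes "finite R0" "n < card R0"
    and R: "\<forall>\<^sub>F i in G. finite (R i) \<and> n + e < card (R i)"
    and count: "\<And>x. x \<notin> R0 \<Longrightarrow> \<forall>\<^sub>F i in G. card {\<rho>\<in>R i. \<rho> < x} = card {\<rho>\<in>R0. \<rho> < x} + e"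
  shows "((\<lambda>i. sorted_list_of_set (R i) ! (n + e)) \<longlongrightarrow> sorted_list_of_set R0 ! n) G"
proof (rule order_tendstoI)
  let ?l = "sorted_list_of_set R0 ! n"
  fix a assume "a < ?l"
  then obtain x where x: "a < x" "x < ?l" "x \<notin> R0" using exists_between_notin assms(1) by blast
  have le: "card {\<rho>\<in>R0. \<rho> < x} \<le> n" using sorted_list_nth_less_iff[OF assms(1,2), of x] x by simp
  from R count[OF x(3)] show "\<forall>\<^sub>F i in G. a < sorted_list_of_set (R i) ! (n + e)"
  proof eventually_elim
    case (elim i)
    then show ?case using sorted_list_nth_less_iff[of "R i" "n + e" x] x le by auto
  qed
next
  let ?l = "sorted_list_of_set R0 ! n"
  fix b assume "?l < b"
  then obtain x where x: "?l < x" "x < b" "x \<notin> R0" using exists_between_notin assms(1) by blast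
  have le: "card {\<rho>\<in>R0. \<rho> < x} > n" using sorted_list_nth_less_iff[OF assms(1,2), of x] x by simp
  from R count[OF x(3)] show "\<forall>\<^sub>F i in G. sorted_list_of_set (R i) ! (n + e) < b"
  proof eventually_elim
    case (elim i)
    then show ?case using sorted_list_nth_less_iff[of "R i" "n + e" x] x le by auto
  qed
qed

text \<open>One zero more than in \<open>R0\<close> is counted below every test point, however far
  to the left, so the smallest zero lies below it.\<close>

lemma sorted_list_hd_at_bot:
  fixes R0 :: "real set"
  assumes "finite R0"
    and R: "\<forall>\<^sub>F i in G. finite (R i) \<and> 0 < card (R i)"
    and count: "\<And>x. x \<notin> R0 \<Longrightarrow> \<forall>\<^sub>F i in G. card {\<rho>\<in>R i. \<rho> < x} = card {\<rho>\<in>R0. \<rho> < x} + 1"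
  shows "filterlim (\<lambda>i. sorted_list_of_set (R i) ! 0) at_bot G"
  unfolding filterlim_at_bot
proof
  fix z :: real
  obtain x where x: "z - 1 < x" "x < z" "x \<notin> R0" using exists_between_notin[of R0 "z
    - 1" z] assms by auto
  from R count[OF x(3)] show "\<forall>\<^sub>F i in G. sorted_list_of_set (R i) ! 0 \<le> z"
  proof eventually_elim
    case (elim i)
    then show ?case using sorted_list_nth_less_iff[of "R i" 0 x] x by simp
  qed
qed

text \<open>Below a fixed test point there are eventually at most \<open>card R0\<close> zeros.
  Indices start at 0, so the zero with index \<open>card R0\<close> is pushed beyond that
  point.\<close>

lemma sorted_list_last_at_top:
  fixes R0 :: "real set"
  assumes "finite R0"
    and R: "\<forall>\<^sub>F i in G. finite (R i) \<and> card R0 < card (R i)"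
    and count: "\<And>x. x \<notin> R0 \<Longrightarrow> \<forall>\<^sub>F i in G. card {\<rho>\<in>R i. \<rho> < x} = card {\<rho>\<in>R0. \<rho> < x}"
  shows "filterlim (\<lambda>i. sorted_list_of_set (R i) ! card R0) at_top G"
  unfolding filterlim_at_top
proof
  fix z :: real
  obtain x where x: "z < x" "x < z + 1" "x \<notin> R0" using exists_between_notin[of R0 z "z
    + 1"] assms by auto
  have le: "card {\<rho>\<in>R0. \<rho> < x} \<le> card R0" using assms by (intro card_mono) auto
  from R count[OF x(3)] show "\<forall>\<^sub>F i in G. z \<le> sorted_list_of_set (R i) ! card R0"
  proof eventually_elim
    case (elim i)
    then show ?case using sorted_list_nth_less_iff[of "R i" "card R0" x] x le by auto
  qed
qed

section \<open>Eigenvalues and their limits\<close>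

text \<open>The boundary condition enters only in this form: the initial data lie on the line
  through \<open>(\<alpha>, \<beta>)\<close>, and \<open>c\<close>, the value at \<open>N\<close>,
  vanishes, while \<open>d\<close>, the quasi-difference at \<open>N\<close>, is free.\<close>

locale sl_problem = sl_bc +
  fixes \<A> :: bc
  assumes bc: "(\<forall>(A, B)\<in>\<A>. A *v vector [a, b] + B *v vector [c, d] = 0) \<longleftrightarrow>
     (\<exists>k. a = k * of_real \<alpha> \<and> b = k * of_real \<beta>) \<and> c = 0"
begin

text \<open>With the quasi-difference as second unknown, the equation is the recurrence of
  \<open>ysl\<close> and \<open>usl\<close>; nonzero \<open>1/f_n\<close> allow passing back. The
  range goes up to \<open>Suc N\<close>, since the equation at \<open>n = N\<close> determines the
  quasi-difference there and with it the last entry.\<close>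

lemma equation_iff:
  fixes v :: "nat \<Rightarrow> complex"
  assumes \<omega>: "\<omega> \<in> Omega N"
  shows "v 0 = k * of_real \<alpha> \<and> quasi_diff \<omega> v 0 = k * of_real \<beta> \<and>
      (\<forall>n\<in>{1..N}. - bwd_diff (quasi_diff \<omega> v) n + complex_of_real (coef_q \<omega> n) * v n
                        = z * complex_of_real (coef_w \<omega> n) * v n)
    \<longleftrightarrow> (\<forall>n\<le>Suc N. v n = k * y \<omega> z n)" (is "?L \<longleftrightarrow> ?R")
proof
  have step: "v (Suc n) = v n + of_real (rec_f \<omega> n) * quasi_diff \<omega> v n" if "n \<le> N" for n
    using rec_f_nz[OF \<omega> that] by (simp add: quasi_diff_def fwd_diff_def coef_f_def)
  have eqn: "(- bwd_diff (quasi_diff \<omega> v) (Suc n) + complex_of_real (coef_q \<omega> (Suc n)) * v (Suc n)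
       = z * complex_of_real (coef_w \<omega> (Suc n)) * v (Suc n)) \<longleftrightarrow>
     quasi_diff \<omega> v (Suc n) = quasi_diff \<omega> v n + (of_real (coef_q \<omega> (Suc n)) - z
       * of_real (coef_w \<omega> (Suc n))) * v (Suc n)" for n
    unfolding bwd_diff_def by (auto simp: algebra_simps)
  show ?R if L: ?L
  proof -
    have "n \<le> N \<Longrightarrow> v n = k * y \<omega> z n \<and> quasi_diff \<omega> v n = k * u \<omega> z n" for n
    proof (induction n)
      case 0
      then show ?case using L by simp
    next
      case (Suc n)
      then have "v (Suc n) = k * y \<omega> z (Suc n)" using step[of n] by (simp add: algebra_simps)
      moreover have "Suc n \<in> {1..N}" using Suc.prems by auto
      then have "quasi_diff \<omega> v (Suc n) = quasi_diff \<omega> v n + (of_real (coef_q \<omega> (Suc n)) - z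
        * of_real (coef_w \<omega> (Suc n))) * v (Suc n)"
        using L eqn by blast
      ultimately show ?case using Suc by (simp add: algebra_simps)
    qed
    then show ?thesis using step[of N] by (auto simp: le_Suc_eq algebra_simps)
  qed
  show ?L if R: ?R
  proof -
    have q: "quasi_diff \<omega> v n = k * u \<omega> z n" if "n \<le> N" for n
    proof -
      have "v n = k * y \<omega> z n" "v (Suc n) = k * y \<omega> z (Suc n)" using R that by auto
      then show ?thesis using rec_f_nz[OF \<omega> that]
        by (simp add: quasi_diff_def fwd_diff_def coef_f_def field_simps)
    qed
    have "- bwd_diff (quasi_diff \<omega> v) n + complex_of_real (coef_q \<omega> n) * v n
                        = z * complex_of_real (coef_w \<omega> n) * v n" if n: "n \<in> {1..N}" for n
    proof -
      obtain m where m: "n = Suc m" "m \<le> N" "Suc m \<le> N" using n by (cases n) auto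
      have "v (Suc m) = k * y \<omega> z (Suc m)" using R m by auto
      then show ?thesis unfolding m eqn q[OF m(2)] q[OF m(3)] usl_Suc
        by (simp add: algebra_simps del: sl_simps)
    qed
    then show ?thesis using R q[of 0] by auto
  qed
qed

definition eigvec :: "sl_eq \<Rightarrow> complex \<Rightarrow> nat \<Rightarrow> complex" where
  "eigvec \<omega> z n = (if n \<le> Suc N then y \<omega> z n else 0)"

lemma eigvec_nz:
  assumes \<omega>: "\<omega> \<in> Omega N"
  shows "eigvec \<omega> z \<noteq> 0"
proof
  assume "eigvec \<omega> z = 0"
  then have *: "eigvec \<omega> z 0 = 0" "eigvec \<omega> z (Suc 0) = 0" by (simp_all add: fun_eq_iff)
  have "y \<omega> z 0 = 0" "y \<omega> z (Suc 0) = 0"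
    using * unfolding eigvec_def by (simp_all del: sl_simps)
  then show False using nontrivial rec_f_nz[OF \<omega>, of 0] by auto
qed

lemma solutions_eq:
  assumes \<omega>: "\<omega> \<in> Omega N"
  shows "solutions N \<omega> \<A> z = (if y \<omega> z N = 0 then cseq.span {eigvec \<omega> z} else {0})"
proof -
  have *: "v \<in> solutions N \<omega> \<A> z \<longleftrightarrow> (\<exists>k. v = cseq_scale k (eigvec \<omega> z) \<and> k * y \<omega> z N = 0)" for v
  proof -
    have "v \<in> solutions N \<omega> \<A> z \<longleftrightarrow> (\<forall>n>Suc N. v n = 0) \<and> v N = 0 \<and>
      (\<exists>k. v 0 = k * of_real \<alpha> \<and> quasi_diff \<omega> v 0 = k * of_real \<beta> \<and>
      (\<forall>n\<in>{1..N}. - bwd_diff (quasi_diff \<omega> v) n + complex_of_real (coef_q \<omega> n) * v n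
                        = z * complex_of_real (coef_w \<omega> n) * v n))"
      unfolding solutions_def bc by auto
    also have "\<dots> \<longleftrightarrow> (\<forall>n>Suc N. v n = 0) \<and> v N = 0 \<and> (\<exists>k. \<forall>n\<le>Suc N. v n = k * y \<omega> z n)"
      unfolding equation_iff[OF \<omega>] ..
    also have "\<dots> \<longleftrightarrow> (\<exists>k. v = cseq_scale k (eigvec \<omega> z) \<and> k * y \<omega> z N = 0)"
      by (auto simp: cseq_scale_def eigvec_def fun_eq_iff not_le)
    finally show ?thesis .
  qed
  have z: "cseq_scale 0 v = 0" for v by (simp add: cseq_scale_def fun_eq_iff)
  show ?thesis using * z by (auto simp: cseq.span_singleton)
qed

lemma eigenvalues_eq:
  assumes \<omega>: "\<omega> \<in> Omega N"
  shows "eigenvalues N \<omega> \<A> = of_real ` rootset \<omega>"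
proof -
  have "z \<in> eigenvalues N \<omega> \<A> \<longleftrightarrow> y \<omega> z N = 0" for z
  proof -
    have "z \<in> eigenvalues N \<omega> \<A> \<longleftrightarrow> (\<exists>v\<in>solutions N \<omega> \<A> z. v \<noteq> 0)"
      by (auto simp: eigenvalues_def fun_eq_iff)
    also have "\<dots> \<longleftrightarrow> y \<omega> z N = 0"
      using eigvec_nz[OF \<omega>, of z] cseq.span_base[of "eigvec \<omega> z" "{eigvec \<omega> z}"]
      by (auto simp: solutions_eq[OF \<omega>])
    finally show ?thesis .
  qed
  then show ?thesis using complex_roots[OF \<omega>] by blast
qed

text \<open>This is geometric simplicity, due to initial data that are unique up to a factor. That
  there are as many distinct zeros as the degree is the separate fact
  \<open>simple_roots\<close>.\<close>

lemma multiplicity_one: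
  assumes \<omega>: "\<omega> \<in> Omega N" and x: "x \<in> rootset \<omega>"
  shows "multiplicity_ev N \<omega> \<A> (of_real x) = 1"
proof -
  have "y \<omega> (complex_of_real x) N = 0" using x complex_roots[OF \<omega>] by blast
  moreover have "cseq.independent {eigvec \<omega> (of_real x)}"
    using eigvec_nz[OF \<omega>] by (simp add: cseq.independent_insert)
  ultimately show ?thesis
    by (simp add: multiplicity_ev_def solutions_eq[OF \<omega>] cseq.dim_eq_card_independent)
qed

lemma is_eig_list:
  assumes \<omega>: "\<omega> \<in> Omega N"
  shows "is_eig_list N \<omega> \<A> (sorted_list_of_set (rootset \<omega>))"
  using y_factorization[OF \<omega>] multiplicity_one[OF \<omega>]
  by (simp add: is_eig_list_def eigenvalues_eq[OF \<omega>] distinct_count_atmost_1[THEN iffD1] flip: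
    count_mset)

lemma
  assumes \<omega>: "\<omega> \<in> Omega N"
  shows eig_eq: "eig N \<A> n \<omega> = sorted_list_of_set (rootset \<omega>) ! n"
    and has_exactly: "has_exactly_evs N \<omega> \<A> (num_eigs \<omega>)"
    and eig_defined_iff: "eig_defined N \<A> n \<omega> \<longleftrightarrow> n < num_eigs \<omega>"
proof -
  have u: "is_eig_list N \<omega> \<A> xs \<longleftrightarrow> xs = sorted_list_of_set (rootset \<omega>)" for xs
    using is_eig_list[OF \<omega>] is_eig_list_unique by blast
  show "eig N \<A> n \<omega> = sorted_list_of_set (rootset \<omega>) ! n"
    by (simp add: eig_def eig_list_def u)
  show "has_exactly_evs N \<omega> \<A> (num_eigs \<omega>)" "eig_defined N \<A> n \<omega> \<longleftrightarrow> n < num_eigs \<omega>"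
    using y_factorization[OF \<omega>] by (simp_all add: has_exactly_evs_def eig_defined_def u)
qed

text \<open>Strictness is what later makes the index shift at a degenerate point a genuine
  discontinuity.\<close>

lemma eig_strict:
  assumes \<omega>: "\<omega> \<in> Omega N" and "Suc n < num_eigs \<omega>"
  shows "eig N \<A> n \<omega> < eig N \<A> (Suc n) \<omega>"
  using assms y_factorization[OF \<omega>] strict_sorted_list_of_set[of "rootset \<omega>"]
  by (simp add: eig_eq sorted_wrt_iff_nth_less)

section \<open>Limits of eigenvalues as the equation varies\<close>

lemma tendsto_coord [tendsto_intros]:
  "((\<lambda>\<omega>. rec_f \<omega> n) \<longlongrightarrow> rec_f \<omega>0 n) (at \<omega>0 within D)"
  "((\<lambda>\<omega>. coef_q \<omega> n) \<longlongrightarrow> coef_q \<omega>0 n) (at \<omega>0 within D)"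
  "((\<lambda>\<omega>. coef_w \<omega> n) \<longlongrightarrow> coef_w \<omega>0 n) (at \<omega>0 within D)"
proof -
  have "continuous_on UNIV rec_f" "continuous_on UNIV coef_q" "continuous_on UNIV coef_w"
    unfolding rec_f_def[abs_def] coef_q_def[abs_def] coef_w_def[abs_def]
      by (intro continuous_intros)+
  then have "continuous_on UNIV (\<lambda>\<omega>. rec_f \<omega> n)" "continuous_on UNIV (\<lambda>\<omega>. coef_q \<omega> n)"
    "continuous_on UNIV (\<lambda>\<omega>. coef_w \<omega> n)"
    by (auto intro: continuous_on_product_then_coordinatewise)
  then show "((\<lambda>\<omega>. rec_f \<omega> n) \<longlongrightarrow> rec_f \<omega>0 n) (at \<omega>0 within D)"
    "((\<lambda>\<omega>. coef_q \<omega> n) \<longlongrightarrow> coef_q \<omega>0 n) (at \<omega>0 within D)"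
    "((\<lambda>\<omega>. coef_w \<omega> n) \<longlongrightarrow> coef_w \<omega>0 n) (at \<omega>0 within D)"
    by (metis UNIV_I continuous_on_def subset_UNIV tendsto_within_subset)+
qed

lemma tendsto_sl:
  assumes "\<And>n. ((\<lambda>i. rec_f (P i) n) \<longlongrightarrow> rec_f \<omega> n) F" "\<And>n. ((\<lambda>i. coef_q (P i) n) \<longlongrightarrow> coef_q \<omega> n) F"
    "\<And>n. ((\<lambda>i. coef_w (P i) n) \<longlongrightarrow> coef_w \<omega> n) F" "(x \<longlongrightarrow> (x0::real)) F"
  shows "((\<lambda>i. y (P i) (x i) n) \<longlongrightarrow> y \<omega> x0 n) F \<and> ((\<lambda>i. u (P i) (x i) n) \<longlongrightarrow> u \<omega> x0 n) F"
  by (induction n) (auto intro!: tendsto_intros assms)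

lemma tendsto_S: "(S \<longlongrightarrow> S \<omega>0) (at \<omega>0 within D)"
  unfolding S_def by (intro tendsto_intros)

lemma eventually_count:
  assumes \<omega>0: "\<omega>0 \<in> Omega N" and D: "D \<subseteq> Omega N" and e: "e \<le> 1"
    and ev: "\<forall>\<^sub>F \<omega> in at \<omega>0 within D. num_eigs \<omega> \<le> Suc (num_eigs \<omega>0) \<and> sgn (lead \<omega>)
      = (-1) ^ e * sgn (lead \<omega>0)"
    and x: "x \<notin> rootset \<omega>0"
  shows "\<forall>\<^sub>F \<omega> in at \<omega>0 within D. card {\<rho>\<in>rootset \<omega>. \<rho> < x} = card {\<rho>\<in>rootset \<omega>0. \<rho> < x} + e"
proof (rule eventually_count_less[where F = "\<lambda>\<omega> x. y \<omega> x N" and ?F0.0 = "\<lambda>x. y \<omega>0 x N" and K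
  = lead and ?K0.0 = "lead \<omega>0"])
  have "\<forall>\<^sub>F \<omega> in at \<omega>0 within D. \<omega> \<in> Omega N"
    using D by (auto simp: eventually_at_filter intro!: always_eventually)
  then show "\<forall>\<^sub>F \<omega> in at \<omega>0 within D. finite (rootset \<omega>) \<and> (\<forall>x. y \<omega> x N
    = lead \<omega> * (\<Prod>\<rho>\<in>rootset \<omega>. \<rho> - x)) \<and>
      card (rootset \<omega>) \<le> Suc (card (rootset \<omega>0)) \<and> sgn (lead \<omega>) = (-1) ^ e * sgn (lead \<omega>0)"
    using ev by eventually_elim (use y_factorization \<omega>0 in auto)
  show "((\<lambda>\<omega>. y \<omega> x N) \<longlongrightarrow> y \<omega>0 x N) (at \<omega>0 within D)" for x :: real
    by (intro tendsto_sl[THEN conjunct1] tendsto_intros)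
qed (use y_factorization[OF \<omega>0] lead_nz[OF \<omega>0] e x in auto)

lemma in_Omega_eventually: "D \<subseteq> Omega N \<Longrightarrow> \<forall>\<^sub>F \<omega> in at \<omega>0 within D. \<omega> \<in> D \<and> \<omega> \<in> Omega N"
  by (auto simp: eventually_at_filter intro!: always_eventually)

lemma regular_eventually:
  assumes \<omega>0: "\<omega>0 \<in> Omega N" and D: "D \<subseteq> Omega N" and S: "S \<omega>0 \<noteq> 0"
  shows "\<forall>\<^sub>F \<omega> in at \<omega>0 within D. num_eigs \<omega> = num_eigs \<omega>0 \<and> sgn (lead \<omega>) = sgn (lead \<omega>0)"
proof -
  \<comment> \<open>\<open>L\<close> is the branch of \<open>lead\<close> valid where
    \<open>S\<close> does not vanish. Unlike \<open>lead\<close>, it is continuous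
    everywhere.\<close>
  define L where "L \<omega> = S \<omega> * (\<Prod>j\<in>{1..<N}. rec_f \<omega> j * coef_w \<omega> j)" for \<omega>
  have lead: "lead \<omega> = L \<omega>" "num_eigs \<omega> = N - 1" if "S \<omega> \<noteq> 0" for \<omega> using that
    by (simp_all add: lead_def num_eigs_def L_def)
  have "L \<omega>0 \<noteq> 0" using lead_nz[OF \<omega>0] lead(1)[OF S] by simp
  moreover have "(L \<longlongrightarrow> L \<omega>0) (at \<omega>0 within D)"
    unfolding L_def by (intro tendsto_intros tendsto_S)
  ultimately have "\<forall>\<^sub>F \<omega> in at \<omega>0 within D. sgn (L \<omega>) = sgn (L \<omega>0)" by (intro eventually_sgn_eq)
  moreover have "\<forall>\<^sub>F \<omega> in at \<omega>0 within D. sgn (S \<omega>) = sgn (S \<omega>0)" using S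
    by (intro eventually_sgn_eq tendsto_S)
  ultimately show ?thesis
  proof eventually_elim
    case (elim \<omega>)
    then have "S \<omega> \<noteq> 0" using S by (auto simp: sgn_0_0)
    with elim lead[OF this] lead[OF S] show ?case by simp
  qed
qed

lemma singular_eventually:
  assumes \<omega>0: "\<omega>0 \<in> Omega N" and D: "D \<subseteq> Omega N" and S: "S \<omega>0 = 0"
    and e: "\<And>\<omega>. \<omega> \<in> D \<Longrightarrow> S \<omega> \<noteq> 0 \<Longrightarrow> sgn (S \<omega> * \<beta>) = (-1) ^ e" "e = 0 \<or> (\<forall>\<omega>\<in>D. S \<omega> \<noteq> 0)"
  shows "\<forall>\<^sub>F \<omega> in at \<omega>0 within D. num_eigs \<omega> \<le> Suc (num_eigs \<omega>0) \<and> sgn (lead \<omega>)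
    = (-1) ^ e * sgn (lead \<omega>0)"
proof -
  define L where "L \<omega> = \<beta> * rec_f \<omega> 1 * (\<Prod>j\<in>{2..<N}. rec_f \<omega> j * coef_w \<omega> j)" for \<omega>
  have \<beta>: "\<beta> \<noteq> 0" using S_zero_imp[OF \<omega>0 S] .
  have L0: "lead \<omega>0 = L \<omega>0" using S by (simp add: lead_def L_def)
  have "L \<omega>0 \<noteq> 0" using lead_nz[OF \<omega>0] L0 by simp
  moreover have "(L \<longlongrightarrow> L \<omega>0) (at \<omega>0 within D)"
    unfolding L_def by (intro tendsto_intros)
  ultimately have "\<forall>\<^sub>F \<omega> in at \<omega>0 within D. sgn (L \<omega>) = sgn (L \<omega>0)" by (intro eventually_sgn_eq)
  then show ?thesis using in_Omega_eventually[OF D]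
  proof eventually_elim
    case (elim \<omega>)
    have "sgn (lead \<omega>) = (-1) ^ e * sgn (L \<omega>)"
    proof (cases "S \<omega> = 0")
      case True
      then show ?thesis using e(2) elim by (auto simp: lead_def L_def)
    next
      case False
      have "{1..<N} = insert 1 {2..<N}" using N by auto
      then have "lead \<omega> = S \<omega> * rec_f \<omega> 1 * coef_w \<omega> 1 * (\<Prod>j\<in>{2..<N}. rec_f \<omega> j * coef_w \<omega> j)"
        using \<open>S \<omega> \<noteq> 0\<close> by (simp add: lead_def)
      moreover have w: "sgn (coef_w \<omega> 1) = 1" using coef_w_pos elim N by auto
      ultimately have "sgn (lead \<omega>) = sgn (S \<omega>) * sgn (rec_f \<omega> 1) * sgn (\<Prod>j\<in>{2..<N}. rec_f \<omega> j
        * coef_w \<omega> j)"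
        by (simp add: sgn_mult)
      also have "\<dots> = sgn (S \<omega> * \<beta>) * sgn (L \<omega>)"
        using \<beta> by (cases "\<beta> > 0") (simp_all add: sgn_mult L_def)
      finally show ?thesis using e(1)[of \<omega>] elim \<open>S \<omega> \<noteq> 0\<close> by simp
    qed
    then show ?case using elim N S by (auto simp: L0 num_eigs_def)
  qed
qed

lemma eig_tendsto_regular:
  assumes \<omega>0: "\<omega>0 \<in> Omega N" and D: "D \<subseteq> Omega N" and S: "S \<omega>0 \<noteq> 0" and n: "n < N - 1"
  shows "(eig N \<A> n \<longlongrightarrow> eig N \<A> n \<omega>0) (at \<omega>0 within D)"
proof -
  have n0: "num_eigs \<omega>0 = N - 1" using S by (simp add: num_eigs_def)
  have "((\<lambda>\<omega>. sorted_list_of_set (rootset \<omega>) ! (n + 0)) \<longlongrightarrow> sorted_list_of_set (rootset \<omega>0) ! n)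
    (at \<omega>0 within D)"
  proof (rule tendsto_sorted_list_nth)
    show "\<forall>\<^sub>F \<omega> in at \<omega>0 within D. finite (rootset \<omega>) \<and> n + 0 < card (rootset \<omega>)"
      using in_Omega_eventually[OF D] regular_eventually[OF \<omega>0 D S]
      by eventually_elim (use y_factorization n n0 in auto)
    show "\<forall>\<^sub>F \<omega> in at \<omega>0 within D. card {\<rho>\<in>rootset \<omega>. \<rho> < x} = card {\<rho>\<in>rootset \<omega>0. \<rho> < x} + 0"
      if "x \<notin> rootset \<omega>0" for x
      by (intro eventually_count \<omega>0 D that eventually_mono[OF regular_eventually[OF \<omega>0 D S]]) auto
  qed (use y_factorization[OF \<omega>0] n n0 in auto)
  then show ?thesis
    unfolding eig_eq[OF \<omega>0]
    by (rule Lim_transform_eventually) (use in_Omega_eventually[OF D] in eventually_elim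
      , simp add: eig_eq)
qed

text \<open>The case \<open>e = 1\<close> is the approach with \<open>S * \<beta> < 0\<close>, where
  the new zero comes from minus infinity and shifts all indices. The case \<open>e = 0\<close> is
  the approach with \<open>S * \<beta> > 0\<close>, possibly through degenerate points, where a new
  zero comes from plus infinity and leaves the lower indices alone.\<close>

lemma eig_tendsto_singular:
  assumes \<omega>0: "\<omega>0 \<in> Omega N" and D: "D \<subseteq> Omega N" and S: "S \<omega>0 = 0"
    and e: "\<And>\<omega>. \<omega> \<in> D \<Longrightarrow> S \<omega> \<noteq> 0 \<Longrightarrow> sgn (S \<omega> * \<beta>) = (-1) ^ e" "e = 0 \<or> (\<forall>\<omega>\<in>D. S \<omega> \<noteq> 0)" "e \<le> 1"
  shows "n < N - 2 \<Longrightarrow> (eig N \<A> (n + e) \<longlongrightarrow> eig N \<A> n \<omega>0) (at \<omega>0 within D)"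
    and "e = 1 \<Longrightarrow> filterlim (eig N \<A> 0) at_bot (at \<omega>0 within D)"
    and "e = 0 \<Longrightarrow> \<forall>\<omega>\<in>D. S \<omega> \<noteq> 0 \<Longrightarrow> filterlim (eig N \<A> (N - 2)) at_top (at \<omega>0 within D)"
proof -
  have n0: "card (rootset \<omega>0) = N - 2" using S y_factorization[OF \<omega>0] by (simp add: num_eigs_def)
  have count: "\<forall>\<^sub>F \<omega> in at \<omega>0 within D. card {\<rho>\<in>rootset \<omega>. \<rho> < x} = card {\<rho>\<in>rootset \<omega>0. \<rho> < x} + e"
    if "x \<notin> rootset \<omega>0" for x
    by (intro eventually_count \<omega>0 D that e(3) singular_eventually[OF \<omega>0 D S e(1,2)]) auto
  have fin: "finite (rootset \<omega>)" "card (rootset \<omega>) = (if S \<omega> = 0 then N - 2 else N - 1)"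
    if "\<omega> \<in> D" for \<omega>
    using y_factorization(1,2)[OF subsetD[OF D that]] by (auto simp: num_eigs_def)
  have eqs: "\<forall>\<^sub>F \<omega> in at \<omega>0 within D. sorted_list_of_set (rootset \<omega>) ! n = eig N \<A> n \<omega>" for n
    using in_Omega_eventually[OF D] by eventually_elim (simp add: eig_eq)
  {
    assume n: "n < N - 2"
    have "((\<lambda>\<omega>. sorted_list_of_set (rootset \<omega>) ! (n + e)) \<longlongrightarrow> sorted_list_of_set (rootset \<omega>0) ! n)
      (at \<omega>0 within D)"
    proof (rule tendsto_sorted_list_nth)
      show "\<forall>\<^sub>F \<omega> in at \<omega>0 within D. finite (rootset \<omega>) \<and> n + e < card (rootset \<omega>)"
        using in_Omega_eventually[OF D] by eventually_elim (use fin n e(2,3) in auto)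
    qed (use count y_factorization[OF \<omega>0] n n0 in auto)
    then show "(eig N \<A> (n + e) \<longlongrightarrow> eig N \<A> n \<omega>0) (at \<omega>0 within D)"
      unfolding eig_eq[OF \<omega>0] by (rule Lim_transform_eventually[OF _ eqs])
  }
  {
    assume e1: "e = 1"
    have "filterlim (\<lambda>\<omega>. sorted_list_of_set (rootset \<omega>) ! 0) at_bot (at \<omega>0 within D)"
    proof (rule sorted_list_hd_at_bot)
      show "\<forall>\<^sub>F \<omega> in at \<omega>0 within D. finite (rootset \<omega>) \<and> 0 < card (rootset \<omega>)"
        using in_Omega_eventually[OF D] by eventually_elim (use fin N e1 e(2) in auto)
    qed (use count y_factorization[OF \<omega>0] e1 in auto)
    then show "filterlim (eig N \<A> 0) at_bot (at \<omega>0 within D)"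
      using filterlim_cong[OF refl refl eqs] by blast
  }
  {
    assume e0: "e = 0" and nz: "\<forall>\<omega>\<in>D. S \<omega> \<noteq> 0"
    have "filterlim (\<lambda>\<omega>. sorted_list_of_set (rootset \<omega>) ! card (rootset \<omega>0)) at_top
      (at \<omega>0 within D)"
    proof (rule sorted_list_last_at_top)
      show "\<forall>\<^sub>F \<omega> in at \<omega>0 within D. finite (rootset \<omega>) \<and> card (rootset \<omega>0) < card (rootset \<omega>)"
        using in_Omega_eventually[OF D] by eventually_elim (use fin N nz n0 in auto)
    qed (use count y_factorization[OF \<omega>0] e0 in auto)
    then show "filterlim (eig N \<A> (N - 2)) at_top (at \<omega>0 within D)"
      unfolding n0 using filterlim_cong[OF refl refl eqs] by blast
  }
qed

end

section \<open>Monotonicity\<close>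

text \<open>The sign of the derivative is known only where \<open>f\<close> is nonnegative. After
  the last point at which \<open>f\<close> is at most \<open>max (f a) 0\<close>, the function stays
  above this level, so it is nonincreasing from there on and cannot end higher.\<close>

lemma max_nonincreasing:
  fixes f :: "real \<Rightarrow> real"
  assumes "a \<le> b" and cont: "continuous_on {a..b} f"
    and D: "\<And>t. a < t \<Longrightarrow> t < b \<Longrightarrow> \<exists>D. DERIV f t :> D \<and> (f t \<ge> 0 \<longrightarrow> D \<le> 0)"
  shows "max (f b) 0 \<le> max (f a) 0"
proof (rule ccontr)
  assume neg: "\<not> ?thesis"
  define m where "m = max (f a) 0"
  have fb: "f b > m" using neg by (auto simp: m_def)
  have "compact ({a..b} \<inter> f -` {..m})"
    using continuous_closed_preimage[OF cont, of "{..m}"]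
    by (simp add: compact_eq_bounded_closed bounded_Int)
  moreover have "a \<in> {a..b} \<inter> f -` {..m}" using \<open>a \<le> b\<close> by (auto simp: m_def)
  ultimately obtain c where c: "c \<in> {a..b}" "f c \<le> m" and max: "\<And>t. t \<in> {a..b} \<Longrightarrow> f t \<le> m \<Longrightarrow> t \<le> c"
    using compact_attains_sup[of "{a..b} \<inter> f -` {..m}"] by blast
  have "c < b" using c fb by (cases "c = b") auto
  then have "f b \<le> f c"
  proof (rule DERIV_nonpos_imp_decreasing_open[OF less_imp_le])
    show "continuous_on {c..b} f" using cont c by (auto elim: continuous_on_subset)
    fix t assume t: "c < t" "t < b"
    then have "f t > m" using max[of t] c by force
    then have "f t \<ge> 0" by (auto simp: m_def)
    then show "\<exists>D. DERIV f t :> D \<and> D \<le> 0" using D[of t] t c by auto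
  qed
  then show False using fb c by simp
qed

lemma min_nondecreasing:
  fixes f :: "real \<Rightarrow> real"
  assumes "a \<le> b" and cont: "continuous_on {a..b} f"
    and D: "\<And>t. a < t \<Longrightarrow> t < b \<Longrightarrow> \<exists>D. DERIV f t :> D \<and> (f t \<le> 0 \<longrightarrow> D \<ge> 0)"
  shows "min (f a) 0 \<le> min (f b) 0"
proof -
  have "max (- f b) 0 \<le> max (- f a) 0"
  proof (rule max_nonincreasing[OF \<open>a \<le> b\<close>])
    show "continuous_on {a..b} (\<lambda>t. - f t)" using cont by (rule continuous_on_minus)
    fix t assume "a < t" "t < b"
    then obtain D where "DERIV f t :> D" "f t \<le> 0 \<longrightarrow> D \<ge> 0" using D by blast
    then show "\<exists>D. DERIV (\<lambda>t. - f t) t :> D \<and> (- f t \<ge> 0 \<longrightarrow> D \<le> 0)"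
      by (intro exI[of _ "- D"]) (auto intro: DERIV_minus)
  qed
  then show ?thesis by (auto simp: max_def min_def split: if_splits)
qed

lemma same_sign_connected:
  fixes g :: "'a::topological_space \<Rightarrow> real"
  assumes "connected C" "continuous_on C g" "\<And>c. c \<in> C \<Longrightarrow> g c \<noteq> 0" "c1 \<in> C" "c2 \<in> C"
  shows "g c1 > 0 \<longleftrightarrow> g c2 > 0"
proof -
  have "connected (g ` C)" using assms by (intro connected_continuous_image)
  have no_zero: "\<not> (g a \<le> 0 \<and> 0 \<le> g b)" if "a \<in> C" "b \<in> C" for a b
  proof
    assume "g a \<le> 0 \<and> 0 \<le> g b"
    moreover have "{g a..g b} \<subseteq> g ` C"
      by (rule connected_contains_Icc) (use \<open>connected (g ` C)\<close> that in auto)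
    ultimately have "0 \<in> g ` C" by auto
    then show False using assms(3) by auto
  qed
  show ?thesis
    using no_zero[of c1 c2] no_zero[of c2 c1] assms(4,5) by linarith
qed

lemma coord_set [simp]:
  "rec_f (set_rec_f j \<omega> t) = (rec_f \<omega>)(j := t)" "coef_q (set_rec_f j \<omega> t) = coef_q \<omega>"
  "coef_w (set_rec_f j \<omega> t) = coef_w \<omega>"
  "rec_f (set_q j \<omega> t) = rec_f \<omega>" "coef_q (set_q j \<omega> t) = (coef_q \<omega>)(j := t)"
  "coef_w (set_q j \<omega> t) = coef_w \<omega>"
  "rec_f (set_w j \<omega> t) = rec_f \<omega>" "coef_q (set_w j \<omega> t) = coef_q \<omega>"
  "coef_w (set_w j \<omega> t) = (coef_w \<omega>)(j := t)"
  by (simp_all add: set_rec_f_def set_q_def set_w_def rec_f_def coef_q_def coef_w_def)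

lemma fun_upd_deriv:
  fixes f :: "nat \<Rightarrow> real"
  shows "((\<lambda>t. (f(j := t)) i) has_real_derivative (if i = j then 1 else 0)) (at t)"
  by (cases "i = j") auto

context sl_problem
begin

lemma continuous_on_eig:
  assumes "n < N - 1"
  shows "continuous_on {\<omega> \<in> Omega N. S \<omega> \<noteq> 0} (eig N \<A> n)"
  unfolding continuous_on_def using assms by (auto intro!: eig_tendsto_regular)

lemma eig_root:
  assumes "\<omega> \<in> Omega N" "S \<omega> \<noteq> 0" "n < N - 1"
  shows "y \<omega> (eig N \<A> n \<omega>) N = 0"
proof -
  have "n < length (sorted_list_of_set (rootset \<omega>))" "finite (rootset \<omega>)"
    using y_factorization[OF assms(1)] assms by (simp_all add: num_eigs_def)
  then have "eig N \<A> n \<omega> \<in> rootset \<omega>"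
    unfolding eig_eq[OF assms(1)] using nth_mem set_sorted_list_of_set by metis
  then show ?thesis by (simp add: rootset_def)
qed

text \<open>The derivative is obtained from the two-point Wronskian identity, in which both boundary
  terms vanish for a pair of eigenfunctions.\<close>

lemma
  fixes p :: "real \<Rightarrow> sl_eq"
  assumes dom: "\<And>t. t \<in> {a..b} \<Longrightarrow> p t \<in> Omega N \<and> S (p t) \<noteq> 0" and n: "n < N - 1"
    and r': "\<And>j t. ((\<lambda>t. rec_f (p t) j) has_real_derivative r' j) (at t)"
    and q': "\<And>j t. ((\<lambda>t. coef_q (p t) j) has_real_derivative q' j) (at t)"
    and w': "\<And>j t. ((\<lambda>t. coef_w (p t) j) has_real_derivative w' j) (at t)"
  defines "\<mu> \<equiv> \<lambda>t. eig N \<A> n (p t)"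
  shows continuous_on_eig_path: "continuous_on {a..b} \<mu>"
    and eig_path_deriv: "\<And>t. t \<in> {a<..<b} \<Longrightarrow> (\<mu> has_real_derivative
      ((\<Sum>j\<in>{1..<N}. q' j * (y (p t) (\<mu> t) j)\<^sup>2) - \<mu> t * (\<Sum>j\<in>{1..<N}. w' j * (y (p t) (\<mu> t) j)\<^sup>2)
       - (\<Sum>j<N. r' j * (u (p t) (\<mu> t) j)\<^sup>2)) / (\<Sum>j\<in>{1..<N}. coef_w (p t) j * (y (p t) (\<mu> t) j)\<^sup>2))
         (at t)"
proof -
  have "continuous_on UNIV (\<lambda>t. (rec_f (p t), coef_q (p t), coef_w (p t)))"
    by (intro continuous_on_Pair continuous_on_coordinatewise_then_product
      continuous_at_imp_continuous_on ballI
        DERIV_isCont[OF r'] DERIV_isCont[OF q'] DERIV_isCont[OF w'])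
  then have contp: "continuous_on {a..b} p"
    unfolding rec_f_def coef_q_def coef_w_def by (auto elim: continuous_on_subset)
  show cont: "continuous_on {a..b} \<mu>"
    unfolding \<mu>_def by (rule continuous_on_compose2[OF continuous_on_eig[OF n] contp]) (use dom in
      auto)
  fix t assume t: "t \<in> {a<..<b}"
  then have t': "t \<in> {a..b}" by auto
  note [tendsto_intros] = DERIV_isCont[OF r', THEN isContD] DERIV_isCont[OF q'
    , THEN isContD] DERIV_isCont[OF w', THEN isContD]
  have "isCont \<mu> t" using cont t continuous_on_interior[of "{a..b}" \<mu> t]
    by (simp add: interior_atLeastAtMost_real)
  then have lim_\<mu> [tendsto_intros]: "(\<mu> \<longlongrightarrow> \<mu> t) (at t)" by (rule isContD)
  have lim_y [tendsto_intros]: "((\<lambda>s. y (p s) (\<mu> s) j) \<longlongrightarrow> y (p t) (\<mu> t) j) (at t)"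
    and lim_u [tendsto_intros]: "((\<lambda>s. u (p s) (\<mu> s) j) \<longlongrightarrow> u (p t) (\<mu> t) j) (at t)" for j
    using tendsto_sl[of p "p t" "at t" \<mu> "\<mu> t" j] by (auto intro!: tendsto_intros)
  have [tendsto_intros]: "((\<lambda>s. (rec_f (p s) j - rec_f (p t) j) / (s - t)) \<longlongrightarrow> r' j) (at t)"
    "((\<lambda>s. (coef_q (p s) j - coef_q (p t) j) / (s - t)) \<longlongrightarrow> q' j) (at t)"
    "((\<lambda>s. (coef_w (p s) j - coef_w (p t) j) / (s - t)) \<longlongrightarrow> w' j) (at t)" for j
    using r'[of j t] q'[of j t] w'[of j t] by (simp_all add: has_field_derivative_iff)
  \<comment> \<open>\<open>W\<close> is the weighted pairing of the eigenfunctions at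
    \<open>t\<close> and \<open>s\<close>, and \<open>Q\<close> collects the difference quotients of
    the coefficients; the Wronskian identity becomes
    \<open>(\<mu> s - \<mu> t) * W s = (s - t) * Q s\<close>. Both converge because
    \<open>\<mu>\<close> is already known to be continuous, and the limit of \<open>W\<close> is a
    positive norm.\<close>
  define W where "W s = (\<Sum>j\<in>{1..<N}. coef_w (p s) j * (y (p t) (\<mu> t) j * y (p s) (\<mu> s) j))" for s
  define Q where "Q s = (\<Sum>j\<in>{1..<N}. (coef_q (p s) j - coef_q (p t) j) / (s - t)
    * (y (p t) (\<mu> t) j * y (p s) (\<mu> s) j))
       - \<mu> t * (\<Sum>j\<in>{1..<N}. (coef_w (p s) j - coef_w (p t) j) / (s - t) * (y (p t) (\<mu> t) j
         * y (p s) (\<mu> s) j))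
       - (\<Sum>j<N. (rec_f (p s) j - rec_f (p t) j) / (s - t) * (u (p t) (\<mu> t) j * u (p s) (\<mu> s) j))"
         for s
  have W: "(W \<longlongrightarrow> W t) (at t)" unfolding W_def by (intro tendsto_intros)
  have Wt: "W t = (\<Sum>j\<in>{1..<N}. coef_w (p t) j * (y (p t) (\<mu> t) j)\<^sup>2)"
    by (simp add: W_def power2_eq_square)
  have y0: "y (p s) (\<mu> s) N = 0" if "s \<in> {a..b}" for s
    unfolding \<mu>_def using dom[OF that] n by (intro eig_root) auto
  have "W t > 0" unfolding Wt using dom[OF t'] y0[OF t'] by (intro weight_pos) auto
  have Q: "(Q \<longlongrightarrow> (\<Sum>j\<in>{1..<N}. q' j * (y (p t) (\<mu> t) j * y (p t) (\<mu> t) j))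
     - \<mu> t * (\<Sum>j\<in>{1..<N}. w' j * (y (p t) (\<mu> t) j * y (p t) (\<mu> t) j))
       - (\<Sum>j<N. r' j * (u (p t) (\<mu> t) j * u (p t) (\<mu> t) j))) (at t)" (is "(_ \<longlongrightarrow> ?Q) _")
    unfolding Q_def by (intro tendsto_intros)
  have "\<forall>\<^sub>F s in at t. W s > 0" using W \<open>W t > 0\<close> by (rule order_tendstoD(1))
  moreover have "\<forall>\<^sub>F s in at t. s \<in> {a<..<b}" using t by (intro eventually_at_in_open') auto
  moreover have "\<forall>\<^sub>F s in at t. s \<noteq> t" by (simp add: eventually_at_filter)
  ultimately have ev: "\<forall>\<^sub>F s in at t. Q s / W s = (\<mu> s - \<mu> t) / (s - t)"
  proof eventually_elim
    case (elim s)
    have s: "s \<in> {a..b}" using elim by auto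
    have "0 = (\<Sum>j<N. (rec_f (p s) j - rec_f (p t) j) * (u (p t) (\<mu> t) j * u (p s) (\<mu> s) j))
      + (\<Sum>j\<in>{1..<N}. ((coef_q (p t) j - coef_q (p s) j) - (\<mu> t * coef_w (p t) j - \<mu> s
        * coef_w (p s) j))
          * (y (p t) (\<mu> t) j * y (p s) (\<mu> s) j))"
      using sl_wronskian[of N \<alpha> \<beta> "p t" "\<mu> t" "p s" "\<mu> s"] y0[OF s] y0[OF t'] N by simp
    also have "(\<Sum>j\<in>{1..<N}. ((coef_q (p t) j - coef_q (p s) j) - (\<mu> t * coef_w (p t) j - \<mu> s
      * coef_w (p s) j))
          * (y (p t) (\<mu> t) j * y (p s) (\<mu> s) j))
       = (\<mu> s - \<mu> t) * W s - (\<Sum>j\<in>{1..<N}. (coef_q (p s) j - coef_q (p t) j) * (y (p t) (\<mu> t) j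
         * y (p s) (\<mu> s) j))
         + \<mu> t * (\<Sum>j\<in>{1..<N}. (coef_w (p s) j - coef_w (p t) j) * (y (p t) (\<mu> t) j
           * y (p s) (\<mu> s) j))"
      unfolding W_def sum_distrib_left sum_subtractf[symmetric] sum.distrib[symmetric]
      by (rule sum.cong) (simp_all add: algebra_simps)
    finally have "(\<mu> s - \<mu> t) * W s = (s - t) * Q s"
      unfolding Q_def sum_distrib_left right_diff_distrib
      using elim by (simp add: mult.left_commute)
    then show ?case using elim by (simp add: field_simps)
  qed
  have "((\<lambda>s. Q s / W s) \<longlongrightarrow> ?Q / W t) (at t)" using Q W \<open>W t > 0\<close> by (intro tendsto_divide) auto
  then have "((\<lambda>s. (\<mu> s - \<mu> t) / (s - t)) \<longlongrightarrow> ?Q / W t) (at t)"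
    by (rule Lim_transform_eventually[OF _ ev])
  then show "(\<mu> has_real_derivative
      ((\<Sum>j\<in>{1..<N}. q' j * (y (p t) (\<mu> t) j)\<^sup>2) - \<mu> t * (\<Sum>j\<in>{1..<N}. w' j * (y (p t) (\<mu> t) j)\<^sup>2)
       - (\<Sum>j<N. r' j * (u (p t) (\<mu> t) j)\<^sup>2)) / (\<Sum>j\<in>{1..<N}. coef_w (p t) j * (y (p t) (\<mu> t) j)\<^sup>2))
         (at t)"
    by (simp add: has_field_derivative_iff Wt power2_eq_square)
qed

lemma weight_nonneg:
  assumes "\<omega> \<in> Omega N"
  shows "(\<Sum>j\<in>{1..<N}. coef_w \<omega> j * (v j :: real)\<^sup>2) \<ge> 0"
  using coef_w_pos[OF assms] by (intro sum_nonneg mult_nonneg_nonneg) (auto intro: less_imp_le)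

context
  fixes C n
  assumes conn: "connected C" and C: "C \<subseteq> {\<omega> \<in> Omega N. S \<omega> \<noteq> 0}" and n: "n < N - 1"
begin

lemma same_sign:
  assumes "\<omega>1 \<in> C" "\<omega>2 \<in> C"
  shows "j \<le> N \<Longrightarrow> rec_f \<omega>1 j > 0 \<longleftrightarrow> rec_f \<omega>2 j > 0" "S \<omega>1 > 0 \<longleftrightarrow> S \<omega>2 > 0"
  using same_sign_connected[OF conn, of "\<lambda>\<omega>. rec_f \<omega> j" \<omega>1 \<omega>2] same_sign_connected[OF conn
    , of S \<omega>1 \<omega>2]
    assms C tendsto_coord(1)[of j] tendsto_S rec_f_nz[of _ j]
  by (auto simp: continuous_on_def subset_iff)

text \<open>The segment between two points of \<open>C\<close> may leave \<open>C\<close>. But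
  connectedness gives \<open>1/f_j\<close> and \<open>S\<close> the same sign at both ends, and both
  are affine along the segment, so it stays in the regular set, which is all that the derivative
  formula needs.\<close>

lemma segment_rec_f:
  assumes "set_rec_f j \<omega> a \<in> C" "set_rec_f j \<omega> b \<in> C" "j \<le> N" "t \<in> {a..b}"
  shows "set_rec_f j \<omega> t \<in> Omega N \<and> S (set_rec_f j \<omega> t) \<noteq> 0"
proof
  have Om: "set_rec_f j \<omega> a \<in> Omega N" "set_rec_f j \<omega> b \<in> Omega N"
    and nz: "S (set_rec_f j \<omega> a) \<noteq> 0" "S (set_rec_f j \<omega> b) \<noteq> 0" using assms C by auto
  have "a > 0 \<longleftrightarrow> b > 0" using same_sign(1)[OF assms(1,2,3)] by simp
  moreover have "a \<noteq> 0" "b \<noteq> 0" using rec_f_nz[OF Om(1) assms(3)] rec_f_nz[OF Om(2) assms(3)]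
    by simp_all
  ultimately have "t \<noteq> 0" using assms(4) by auto
  then show "set_rec_f j \<omega> t \<in> Omega N"
    using Om(1) assms(3) by (auto simp: Omega_def split: if_splits)
  show "S (set_rec_f j \<omega> t) \<noteq> 0"
  proof (cases "j = 0")
    case True
    have S: "S (set_rec_f j \<omega> t) = \<alpha> + t * \<beta>" for t using True by (simp add: S_def)
    have "a * \<beta> \<le> t * \<beta> \<and> t * \<beta> \<le> b * \<beta> \<or> b * \<beta> \<le> t * \<beta> \<and> t * \<beta> \<le> a * \<beta>"
      using assms(4) by (cases "\<beta> \<ge> 0") (auto intro: mult_right_mono mult_right_mono_neg)
    then show ?thesis using same_sign(2)[OF assms(1,2)] nz unfolding S by linarith
  next
    case False
    then show ?thesis using nz(1) by (simp add: S_def)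
  qed
qed

lemma segment_q:
  assumes "set_q j \<omega> a \<in> C" "j \<in> {1..N}"
  shows "set_q j \<omega> t \<in> Omega N \<and> S (set_q j \<omega> t) \<noteq> 0"
proof -
  have "set_q j \<omega> a \<in> Omega N" "S (set_q j \<omega> a) \<noteq> 0" using assms C by auto
  then show ?thesis using assms(2) by (auto simp: Omega_def S_def split: if_splits)
qed

lemma segment_w:
  assumes "set_w j \<omega> a \<in> C" "j \<in> {1..N}" "a \<le> t"
  shows "set_w j \<omega> t \<in> Omega N \<and> S (set_w j \<omega> t) \<noteq> 0"
proof -
  have "set_w j \<omega> a \<in> Omega N" "S (set_w j \<omega> a) \<noteq> 0" using assms C by auto
  then show ?thesis using assms(2,3) by (auto simp: Omega_def S_def split: if_splits)
qed

text \<open>The derivative formula reduces to minus the square of \<open>u_j\<close> over the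
  weighted norm, and to zero for \<open>j = N\<close>.\<close>

lemma eig_antimono_rec_f:
  assumes "set_rec_f j \<omega> a \<in> C" "set_rec_f j \<omega> b \<in> C" "j \<le> N" "a \<le> b"
  shows "eig N \<A> n (set_rec_f j \<omega> b) \<le> eig N \<A> n (set_rec_f j \<omega> a)"
proof -
  let ?p = "set_rec_f j \<omega>"
  note dom = segment_rec_f[OF assms(1-3)]
  have r: "((\<lambda>t. rec_f (?p t) i) has_real_derivative (if i = j then 1 else 0)) (at t)"
    and q: "((\<lambda>t. coef_q (?p t) i) has_real_derivative 0) (at t)"
    and w: "((\<lambda>t. coef_w (?p t) i) has_real_derivative 0) (at t)" for i t
    using fun_upd_deriv by simp_all
  show ?thesis
  proof (rule DERIV_nonpos_imp_decreasing_open[OF assms(4) _ continuous_on_eig_path[OF dom n r q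
    w]])
    fix t assume "a < t" "t < b"
    then have t: "t \<in> {a<..<b}" "t \<in> {a..b}" by auto
    show "\<exists>D. ((\<lambda>t. eig N \<A> n (?p t)) has_real_derivative D) (at t) \<and> D \<le> 0"
      using eig_path_deriv[OF dom n r q w t(1)]
      by (intro exI conjI, assumption) (intro divide_nonpos_nonneg weight_nonneg
        , simp_all add: sum_nonneg dom[OF t(2)])
  qed
qed

lemma eig_mono_q:
  assumes "set_q j \<omega> a \<in> C" "j \<in> {1..N}" "a \<le> b"
  shows "eig N \<A> n (set_q j \<omega> a) \<le> eig N \<A> n (set_q j \<omega> b)"
proof -
  let ?p = "set_q j \<omega>"
  note dom = segment_q[OF assms(1-2)]
  have r: "((\<lambda>t. rec_f (?p t) i) has_real_derivative 0) (at t)"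
    and q: "((\<lambda>t. coef_q (?p t) i) has_real_derivative (if i = j then 1 else 0)) (at t)"
    and w: "((\<lambda>t. coef_w (?p t) i) has_real_derivative 0) (at t)" for i t
    using fun_upd_deriv by simp_all
  show ?thesis
  proof (rule DERIV_nonneg_imp_increasing_open[OF assms(3) _ continuous_on_eig_path[OF dom n r q
    w]])
    fix t assume "a < t" "t < b"
    then have t: "t \<in> {a<..<b}" by auto
    show "\<exists>D. ((\<lambda>t. eig N \<A> n (?p t)) has_real_derivative D) (at t) \<and> D \<ge> 0"
      using eig_path_deriv[OF dom n r q w t]
      by (intro exI conjI, assumption) (intro divide_nonneg_nonneg weight_nonneg
        , simp_all add: sum_nonneg dom)
  qed
qed

text \<open>The weight is multiplied by the spectral parameter, so the derivative is
  \<open>- \<mu> * g\<close> with \<open>g \<ge> 0\<close>. Its sign is opposite to that of the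
  eigenvalue, which is why positive and negative parts are treated separately.\<close>

lemma eig_mono_w:
  assumes "set_w j \<omega> a \<in> C" "j \<in> {1..N}" "a \<le> b"
  shows "max (eig N \<A> n (set_w j \<omega> b)) 0 \<le> max (eig N \<A> n (set_w j \<omega> a)) 0"
    and "min (eig N \<A> n (set_w j \<omega> a)) 0 \<le> min (eig N \<A> n (set_w j \<omega> b)) 0"
proof -
  let ?p = "set_w j \<omega>" and ?\<mu> = "\<lambda>t. eig N \<A> n (set_w j \<omega> t)"
  have dom: "?p t \<in> Omega N \<and> S (?p t) \<noteq> 0" if "t \<in> {a..b}" for t
    using segment_w[OF assms(1-2)] that by auto
  have r: "((\<lambda>t. rec_f (?p t) i) has_real_derivative 0) (at t)"
    and q: "((\<lambda>t. coef_q (?p t) i) has_real_derivative 0) (at t)"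
    and w: "((\<lambda>t. coef_w (?p t) i) has_real_derivative (if i = j then 1 else 0)) (at t)" for i t
    using fun_upd_deriv by simp_all
  note cont = continuous_on_eig_path[OF dom n r q w]
  have D: "\<exists>g\<ge>0. (?\<mu> has_real_derivative - ?\<mu> t * g) (at t)" if "a < t" "t < b" for t
  proof -
    have t: "t \<in> {a<..<b}" "t \<in> {a..b}" using that by auto
    define A where "A = (\<Sum>i\<in>{1..<N}. (if i = j then 1 else 0) * (y (?p t) (?\<mu> t) i)\<^sup>2)"
    define B where "B = (\<Sum>i\<in>{1..<N}. coef_w (?p t) i * (y (?p t) (?\<mu> t) i)\<^sup>2)"
    have "A \<ge> 0" "B \<ge> 0" unfolding A_def B_def using dom[OF t(2)]
      by (auto intro!: sum_nonneg weight_nonneg simp del: One_nat_def coord_set)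
    moreover have "(?\<mu> has_real_derivative - ?\<mu> t * (A / B)) (at t)"
      using eig_path_deriv[OF dom n r q w t(1)] unfolding A_def[symmetric] B_def[symmetric] by simp
    ultimately show ?thesis by (intro exI[of _ "A / B"]) simp
  qed
  show "max (?\<mu> b) 0 \<le> max (?\<mu> a) 0"
  proof (rule max_nonincreasing[OF assms(3) cont])
    fix t assume "a < t" "t < b"
    then obtain g where "g \<ge> 0" "(?\<mu> has_real_derivative - ?\<mu> t * g) (at t)" using D by blast
    then show "\<exists>D. (?\<mu> has_real_derivative D) (at t) \<and> (?\<mu> t \<ge> 0 \<longrightarrow> D \<le> 0)"
      by (intro exI[of _ "- ?\<mu> t * g"]) simp
  qed
  show "min (?\<mu> a) 0 \<le> min (?\<mu> b) 0"
  proof (rule min_nondecreasing[OF assms(3) cont])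
    fix t assume "a < t" "t < b"
    then obtain g where "g \<ge> 0" "(?\<mu> has_real_derivative - ?\<mu> t * g) (at t)" using D by blast
    then show "\<exists>D. (?\<mu> has_real_derivative D) (at t) \<and> (?\<mu> t \<le> 0 \<longrightarrow> D \<ge> 0)"
      by (intro exI[of _ "- ?\<mu> t * g"]) (simp add: mult_nonpos_nonneg)
  qed
qed

lemma eig_indep_rec_f_N:
  assumes "set_rec_f N \<omega> t \<in> C" "\<omega> \<in> C"
  shows "eig N \<A> n (set_rec_f N \<omega> t) = eig N \<A> n \<omega>"
proof -
  have "y (set_rec_f N \<omega> t) x N = y \<omega> x N" for x :: real
    unfolding ysl_def by (rule sol_cong[THEN conjunct1]) auto
  then have "rootset (set_rec_f N \<omega> t) = rootset \<omega>" by (simp add: rootset_def)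
  moreover have "set_rec_f N \<omega> t \<in> Omega N" "\<omega> \<in> Omega N" using assms C by auto
  ultimately show ?thesis by (simp add: eig_eq)
qed

lemma monotonicity: "monotonicity_M N (eig N \<A> n) C"
  unfolding monotonicity_M_def
proof (intro ballI conjI allI impI)
  fix \<omega> assume \<omega>: "\<omega> \<in> C"
  show "antimono_on {t. set_rec_f j \<omega> t \<in> C} (\<lambda>t. eig N \<A> n (set_rec_f j \<omega> t))" if "j < N" for j
    using that by (intro monotone_onI) (auto intro: eig_antimono_rec_f)
  show "(\<lambda>t. eig N \<A> n (set_rec_f N \<omega> t)) constant_on {t. set_rec_f N \<omega> t \<in> C}"
    unfolding constant_on_def using eig_indep_rec_f_N[OF _ \<omega>] by auto
  fix j assume j: "j \<in> {1..N}"
  show "mono_on {t. set_q j \<omega> t \<in> C} (\<lambda>t. eig N \<A> n (set_q j \<omega> t))"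
    using j by (intro monotone_onI) (auto intro: eig_mono_q)
  show "antimono_on {t. set_w j \<omega> t \<in> C} (\<lambda>t. max (eig N \<A> n (set_w j \<omega> t)) 0)"
    using j by (intro monotone_onI) (auto simp del: max.bounded_iff intro: eig_mono_w)
  show "mono_on {t. set_w j \<omega> t \<in> C} (\<lambda>t. min (eig N \<A> n (set_w j \<omega> t)) 0)"
    using j by (intro monotone_onI) (auto simp del: min.bounded_iff intro: eig_mono_w)
qed

end

section \<open>The regular and the degenerate case\<close>

lemma eig_continuous_on_regular:
  assumes "D \<subseteq> {\<omega> \<in> Omega N. S \<omega> \<noteq> 0}" "n < N - 1"
  shows "eig_continuous_on N \<A> n D"
  unfolding eig_continuous_on_def eig_continuous_at_def continuous_within
proof (intro ballI conjI)
  fix \<omega> assume "\<omega> \<in> D"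
  then have \<omega>: "\<omega> \<in> Omega N" "S \<omega> \<noteq> 0" using assms by auto
  then show "eig_defined N \<A> n \<omega>" using assms(2) by (simp add: eig_defined_iff num_eigs_def)
  show "(eig N \<A> n \<longlongrightarrow> eig N \<A> n \<omega>) (at \<omega> within {\<omega>' \<in> D. eig_defined N \<A> n \<omega>'})"
    using assms by (intro eig_tendsto_regular \<omega>) auto
qed

text \<open>Limits from the minus side contradict continuity only if that side accumulates at
  \<open>\<omega>\<close>. Lowering \<open>1/f_0\<close> alone achieves this, since then
  \<open>S * \<beta>\<close> is \<open>\<beta>\<close> squared times the negative increment.\<close>

lemma approach_singular:
  assumes \<omega>: "\<omega> \<in> Omega N" and S: "S \<omega> = 0"
  shows "at \<omega> within {\<omega> \<in> Omega N. S \<omega> * \<beta> < 0} \<noteq> bot"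
proof
  assume bot: "at \<omega> within {\<omega> \<in> Omega N. S \<omega> * \<beta> < 0} = bot"
  let ?r = "rec_f \<omega> 0"
  have r: "?r \<noteq> 0" and \<beta>: "\<beta> \<noteq> 0" using rec_f_nz[OF \<omega>, of 0] S_zero_imp[OF \<omega> S] by auto
  have "\<forall>\<^sub>F t in at_left ?r. t \<noteq> 0"
    using tendsto_ident_at r by (rule tendsto_imp_eventually_ne)
  moreover have "\<forall>\<^sub>F t in at_left ?r. t < ?r" by (simp add: eventually_at_filter)
  ultimately have ev: "\<forall>\<^sub>F t in at_left ?r. set_rec_f 0 \<omega> t \<in> {\<omega> \<in> Omega N. S \<omega> * \<beta> < 0}
    \<and> set_rec_f 0 \<omega> t \<noteq> \<omega>"
  proof eventually_elim
    case (elim t)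
    have "S (set_rec_f 0 \<omega> t) * \<beta> = (S \<omega> + (t - ?r) * \<beta>) * \<beta>" by (simp add: S_def algebra_simps)
    also have "\<dots> = (t - ?r) * \<beta>\<^sup>2" using S by (simp add: power2_eq_square)
    also have "\<dots> < 0" using elim \<beta> by (simp add: mult_less_0_iff)
    finally have "S (set_rec_f 0 \<omega> t) * \<beta> < 0" .
    moreover have "set_rec_f 0 \<omega> t \<in> Omega N" using \<omega> elim by (auto simp: Omega_def)
    moreover have "rec_f (set_rec_f 0 \<omega> t) 0 \<noteq> ?r" using elim by simp
    then have "set_rec_f 0 \<omega> t \<noteq> \<omega>" by metis
    ultimately show ?case by blast
  qed
  have "continuous_on UNIV (\<lambda>t. (((rec_f \<omega>)(0 := t)), coef_q \<omega>, coef_w \<omega>))"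
    by (intro continuous_on_Pair continuous_on_coordinatewise_then_product continuous_on_const
          continuous_at_imp_continuous_on ballI DERIV_isCont[OF fun_upd_deriv])
  then have "isCont (set_rec_f 0 \<omega>) ?r"
    unfolding set_rec_f_def by (auto simp: continuous_on_eq_continuous_at)
  then have "(set_rec_f 0 \<omega> \<longlongrightarrow> set_rec_f 0 \<omega> ?r) (at_left ?r)"
    unfolding isCont_def by (rule tendsto_within_subset) simp
  moreover have "set_rec_f 0 \<omega> ?r = \<omega>" by (simp add: set_rec_f_def rec_f_def coef_q_def coef_w_def)
  ultimately have "filterlim (set_rec_f 0 \<omega>) (at \<omega> within {\<omega> \<in> Omega N. S \<omega> * \<beta> < 0}) (at_left ?r)"
    using ev by (simp add: filterlim_at)
  then have "eventually (\<lambda>_. False) (at_left ?r)"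
    unfolding bot filterlim_iff by (auto dest: spec[of _ "\<lambda>_. False"])
  then show False by (simp add: trivial_limit_at_left_real)
qed

text \<open>The sides are given by \<open>S * \<beta>\<close> instead of \<open>S\<close>: for
  nonzero \<open>\<beta>\<close> this is \<open>\<beta>\<close> squared times the deviation of
  \<open>1/f_0\<close> from its critical value, so the sign of \<open>\<beta>\<close> drops
  out.\<close>

lemma singular_case:
  assumes E: "E = {\<omega> \<in> Omega N. S \<omega> = 0}" and Ep: "Ep = {\<omega> \<in> Omega N. S \<omega> * \<beta> > 0}"
    and Em: "Em = {\<omega> \<in> Omega N. S \<omega> * \<beta> < 0}"
  shows "(\<forall>\<omega> \<in> E. has_exactly_evs N \<omega> \<A> (N - 2)) \<and>
       (\<forall>\<omega> \<in> Omega N - E. has_exactly_evs N \<omega> \<A> (N - 1)) \<and>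
       (\<forall>n. n + 2 \<le> N \<longrightarrow> eig_continuous_on N \<A> n (Omega N - E)) \<and>
       (\<forall>n. n + 2 \<le> N \<longrightarrow>
          (\<forall>C \<in> components Ep \<union> components Em. monotonicity_M N (eig N \<A> n) C)) \<and>
       (\<forall>n. n + 2 \<le> N \<longrightarrow> (\<forall>\<omega> \<in> E. \<not> eig_continuous_at N \<A> n (Omega N) \<omega>)) \<and>
       (\<forall>\<omega>\<^sub>0 \<in> E.
          filterlim (eig N \<A> 0) at_bot (at \<omega>\<^sub>0 within Em) \<and>
          (\<forall>n. 1 \<le> n \<and> n + 2 \<le> N \<longrightarrow>
             (eig N \<A> n \<longlongrightarrow> eig N \<A> (n - 1) \<omega>\<^sub>0) (at \<omega>\<^sub>0 within Em)) \<and>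
          (\<forall>n. n + 3 \<le> N \<longrightarrow>
             (eig N \<A> n \<longlongrightarrow> eig N \<A> n \<omega>\<^sub>0) (at \<omega>\<^sub>0 within Ep \<union> E)) \<and>
          filterlim (eig N \<A> (N - 2)) at_top (at \<omega>\<^sub>0 within Ep)) \<and>
       (\<forall>n. n + 3 \<le> N \<longrightarrow> eig_continuous_on N \<A> n (Ep \<union> E))"
proof (intro conjI ballI allI impI)
  show "has_exactly_evs N \<omega> \<A> (N - 2)" if "\<omega> \<in> E" for \<omega>
    using has_exactly[of \<omega>] that by (simp add: E num_eigs_def)
  show "has_exactly_evs N \<omega> \<A> (N - 1)" if "\<omega> \<in> Omega N - E" for \<omega>
    using has_exactly[of \<omega>] that by (simp add: E num_eigs_def)
  show "eig_continuous_on N \<A> n (Omega N - E)" if "n + 2 \<le> N" for n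
    using that E by (intro eig_continuous_on_regular) auto
  show "monotonicity_M N (eig N \<A> n) C" if "n + 2 \<le> N" "C \<in> components Ep \<union> components Em" for n C
  proof (rule monotonicity)
    show "connected C" using that(2) in_components_connected by blast
    show "C \<subseteq> {\<omega> \<in> Omega N. S \<omega> \<noteq> 0}" 
    proof -
      have "C \<subseteq> Ep \<union> Em" using that(2) in_components_subset by blast
      also have "\<dots> \<subseteq> {\<omega> \<in> Omega N. S \<omega> \<noteq> 0}" using Ep Em by auto
      finally show ?thesis .
    qed
  qed (use that in auto)
  have bot: "filterlim (eig N \<A> 0) at_bot (at \<omega>\<^sub>0 within Em)"
    and minus: "1 \<le> n \<and> n + 2 \<le> N \<Longrightarrow> (eig N \<A> n \<longlongrightarrow> eig N \<A> (n - 1) \<omega>\<^sub>0) (at \<omega>\<^sub>0 within Em)"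
    if "\<omega>\<^sub>0 \<in> E" for \<omega>\<^sub>0 n
  proof -
    have *: "\<omega>\<^sub>0 \<in> Omega N" "S \<omega>\<^sub>0 = 0" "Em \<subseteq> Omega N" using that E Em by auto
    have e: "sgn (S \<omega> * \<beta>) = (-1) ^ 1" if "\<omega> \<in> Em" for \<omega> using that Em by auto
    have nz: "\<forall>\<omega>\<in>Em. S \<omega> \<noteq> 0" using Em by auto
    show "filterlim (eig N \<A> 0) at_bot (at \<omega>\<^sub>0 within Em)"
      using eig_tendsto_singular(2)[OF *(1) *(3) *(2), of 1] e nz by blast
    show "(eig N \<A> n \<longlongrightarrow> eig N \<A> (n - 1) \<omega>\<^sub>0) (at \<omega>\<^sub>0 within Em)" if "1 \<le> n \<and> n + 2 \<le> N"
    proof -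
      have "n - 1 < N - 2" "n - 1 + 1 = n" using that by arith+
      then show ?thesis using eig_tendsto_singular(1)[OF *(1) *(3) *(2), of 1 "n - 1"] e nz by simp
    qed
  qed
  show "filterlim (eig N \<A> 0) at_bot (at \<omega>\<^sub>0 within Em)" if "\<omega>\<^sub>0 \<in> E" for \<omega>\<^sub>0 by (rule bot[OF that])
  show "(eig N \<A> n \<longlongrightarrow> eig N \<A> (n - 1) \<omega>\<^sub>0) (at \<omega>\<^sub>0 within Em)" if "\<omega>\<^sub>0 \<in> E" "1 \<le> n \<and> n + 2 \<le> N"
    for \<omega>\<^sub>0 n
    by (rule minus[OF that])
  have plus: "(eig N \<A> n \<longlongrightarrow> eig N \<A> n \<omega>\<^sub>0) (at \<omega>\<^sub>0 within D)" if "\<omega>\<^sub>0 \<in> E" "n + 3 \<le> N" "D \<subseteq> Ep \<union> E"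
    for \<omega>\<^sub>0 n D
  proof -
    have *: "\<omega>\<^sub>0 \<in> Omega N" "S \<omega>\<^sub>0 = 0" "D \<subseteq> Omega N" using that E Ep by auto
    have e: "sgn (S \<omega> * \<beta>) = (-1) ^ 0" if "\<omega> \<in> D" "S \<omega> \<noteq> 0" for \<omega>
      using that \<open>D \<subseteq> Ep \<union> E\<close> Ep E by auto
    show ?thesis
      using eig_tendsto_singular(1)[OF *(1) *(3) *(2), of 0 n] e that by simp
  qed
  then show "(eig N \<A> n \<longlongrightarrow> eig N \<A> n \<omega>\<^sub>0) (at \<omega>\<^sub>0 within Ep \<union> E)" if "\<omega>\<^sub>0 \<in> E" "n + 3 \<le> N" for \<omega>\<^sub>0 n
    using that by blast
  show "filterlim (eig N \<A> (N - 2)) at_top (at \<omega>\<^sub>0 within Ep)" if "\<omega>\<^sub>0 \<in> E" for \<omega>\<^sub>0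
  proof -
    have *: "\<omega>\<^sub>0 \<in> Omega N" "S \<omega>\<^sub>0 = 0" "Ep \<subseteq> Omega N" using that E Ep by auto
    have e: "sgn (S \<omega> * \<beta>) = (-1) ^ 0" "S \<omega> \<noteq> 0" if "\<omega> \<in> Ep" for \<omega> using that Ep by auto
    show ?thesis
      using eig_tendsto_singular(3)[OF *(1) *(3) *(2), of 0] e by blast
  qed
  show "\<not> eig_continuous_at N \<A> n (Omega N) \<omega>" if "n + 2 \<le> N" "\<omega> \<in> E" for n \<omega>
  proof
    assume "eig_continuous_at N \<A> n (Omega N) \<omega>"
    \<comment> \<open>Continuity includes being defined, which excludes \<open>n = N - 2\<close>.
      For smaller \<open>n\<close> the limit from \<open>Em\<close> is minus infinity or the
      strictly smaller \<open>\<lambda>_(n-1)\<close>.\<close>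
    then have n: "n < N - 2" and lim: "(eig N \<A> n \<longlongrightarrow> eig N \<A> n \<omega>)
      (at \<omega> within {\<omega>' \<in> Omega N. eig_defined N \<A> n \<omega>'})"
      using that E by (auto simp: eig_continuous_at_def continuous_within eig_defined_iff
        num_eigs_def)
    have "Em \<subseteq> {\<omega>' \<in> Omega N. eig_defined N \<A> n \<omega>'}"
      using Em n by (auto simp: eig_defined_iff num_eigs_def)
    then have lim: "(eig N \<A> n \<longlongrightarrow> eig N \<A> n \<omega>) (at \<omega> within Em)" using lim
      by (rule tendsto_within_subset[rotated])
    have nontriv: "at \<omega> within Em \<noteq> bot" using approach_singular that E Em by auto
    show False
    proof (cases n)
      case 0
      have "\<forall>\<^sub>F \<omega>' in at \<omega> within Em. eig N \<A> n \<omega> - 1 < eig N \<A> n \<omega>'" using lim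
        by (rule order_tendstoD) simp
      moreover have "\<forall>\<^sub>F \<omega>' in at \<omega> within Em. eig N \<A> n \<omega>' \<le> eig N \<A> n \<omega> - 1"
        using bot[OF that(2)] 0 by (simp add: filterlim_at_bot)
      ultimately have "\<forall>\<^sub>F \<omega>' in at \<omega> within Em. False" by eventually_elim simp
      then show False using nontriv by (simp add: trivial_limit_def)
    next
      case (Suc m)
      have "eig N \<A> n \<omega> = eig N \<A> m \<omega>"
        using tendsto_unique[OF nontriv lim minus[OF that(2), of n]] that(1) Suc by simp
      moreover have "eig N \<A> m \<omega> < eig N \<A> n \<omega>"
        using eig_strict[of \<omega> m] that E n Suc by (simp add: num_eigs_def)
      ultimately show False by simp
    qed
  qed
  show "eig_continuous_on N \<A> n (Ep \<union> E)" if "n + 3 \<le> N" for n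
    unfolding eig_continuous_on_def eig_continuous_at_def continuous_within
  proof (intro ballI conjI)
    fix \<omega> assume \<omega>: "\<omega> \<in> Ep \<union> E"
    then have Om: "\<omega> \<in> Omega N" using E Ep by auto
    then show "eig_defined N \<A> n \<omega>" using that by (auto simp add: eig_defined_iff num_eigs_def)
    show "(eig N \<A> n \<longlongrightarrow> eig N \<A> n \<omega>) (at \<omega> within {\<omega>' \<in> Ep \<union> E. eig_defined N \<A> n \<omega>'})"
    proof (cases "\<omega> \<in> E")
      case True
      then show ?thesis using that by (intro plus) auto
    next
      case False
      then show ?thesis using that \<omega> E Ep by (intro eig_tendsto_regular Om) auto
    qed
  qed
qed

lemma regular_case:
  assumes S: "\<And>\<omega>. \<omega> \<in> Omega N \<Longrightarrow> S \<omega> \<noteq> 0"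
  shows "(\<forall>\<omega> \<in> Omega N. has_exactly_evs N \<omega> \<A> (N - 1)) \<and>
       (\<forall>n. n + 2 \<le> N \<longrightarrow> eig_continuous_on N \<A> n (Omega N)) \<and>
       (\<forall>n. n + 2 \<le> N \<longrightarrow> (\<forall>C \<in> components (Omega N). monotonicity_M N (eig N \<A> n) C))"
proof (intro conjI ballI allI impI)
  show "has_exactly_evs N \<omega> \<A> (N - 1)" if "\<omega> \<in> Omega N" for \<omega>
    using has_exactly[OF that] S[OF that] by (simp add: num_eigs_def)
  show "eig_continuous_on N \<A> n (Omega N)" if "n + 2 \<le> N" for n
    using S that by (intro eig_continuous_on_regular) auto
  show "monotonicity_M N (eig N \<A> n) C" if "n + 2 \<le> N" "C \<in> components (Omega N)" for n C
    using S that(1) in_components_connected[OF that(2)] in_components_subset[OF that(2)]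
    by (intro monotonicity) (blast | simp)+
qed

end

section \<open>Boundary conditions\<close>

lemma bc_class_refl: "(A, B) \<in> bc_class A B"
proof -
  have "invertible (mat 1 :: complex^2^2)" by (simp add: invertible_def)
  then show ?thesis unfolding bc_class_def by (force intro: exI[of _ "mat 1"])
qed

lemma bc_class_condition:
  "(\<forall>(A', B')\<in>bc_class A B. A' *v v + B' *v w = 0) \<longleftrightarrow> A *v v + B *v w = 0"
proof
  assume "\<forall>(A', B')\<in>bc_class A B. A' *v v + B' *v w = 0"
  then show "A *v v + B *v w = 0" using bc_class_refl by blast
next
  assume *: "A *v v + B *v w = 0"
  have "(T ** A) *v v + (T ** B) *v w = T *v (A *v v + B *v w)" for T
    by (simp add: matrix_vector_mul_assoc matrix_vector_right_distrib)
  then show "\<forall>(A', B')\<in>bc_class A B. A' *v v + B' *v w = 0" using * by (auto simp: bc_class_def)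
qed

lemma bc_class_mult:
  assumes "invertible T"
  shows "bc_class (T ** A) (T ** B) = bc_class A B"
proof
  have "(U ** (T ** A), U ** (T ** B)) \<in> bc_class A B" if "invertible U" for U
    using invertible_mult[OF that assms] unfolding bc_class_def by (auto simp: matrix_mul_assoc)
  then show "bc_class (T ** A) (T ** B) \<subseteq> bc_class A B" by (auto simp: bc_class_def)
  obtain T' where T': "T' ** T = mat 1" "T ** T' = mat 1" using assms by (auto simp: invertible_def)
  have "(U ** A, U ** B) \<in> bc_class (T ** A) (T ** B)" if "invertible U" for U
  proof -
    have "invertible (U ** T')" using T' by (intro invertible_mult that) (auto simp: invertible_def)
    moreover have "U ** T' ** (T ** C) = U ** C" for C :: "complex^2^2"
      using T' by (metis matrix_mul_assoc matrix_mul_rid)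
    ultimately show ?thesis unfolding bc_class_def mem_Collect_eq by (metis (no_types, lifting))
  qed
  then show "bc_class A B \<subseteq> bc_class (T ** A) (T ** B)" by (auto simp: bc_class_def)
qed

lemmas mat2_simps = vec_eq_iff forall_2 matrix_vector_mult_def matrix_matrix_mult_def sum_2 vector_2

text \<open>The first row \<open>(a, -1)\<close> annihilates exactly the multiples of
  \<open>(1, a)\<close>; the second row says \<open>y_N = 0\<close>. For \<open>Ahat2\<close> the
  row \<open>(1, a)\<close> annihilates the multiples of \<open>(-a, 1)\<close>.\<close>

lemma sl_problem_Ahat1:
  assumes "N \<ge> 2"
  shows "sl_problem N 1 a (Ahat1 a)"
proof
  fix p q c d :: complex
  show "(\<forall>(A, B)\<in>Ahat1 a. A *v vector [p, q] + B *v vector [c, d] = 0) \<longleftrightarrow>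
     (\<exists>k. p = k * of_real 1 \<and> q = k * of_real a) \<and> c = 0"
    unfolding Ahat1_def bc_class_condition by (auto simp: mat2_simps mult.commute)
qed (use assms in auto)

lemma sl_problem_Ahat2:
  assumes "N \<ge> 2"
  shows "sl_problem N (- a) 1 (Ahat2 a)"
proof
  fix p q c d :: complex
  show "(\<forall>(A, B)\<in>Ahat2 a. A *v vector [p, q] + B *v vector [c, d] = 0) \<longleftrightarrow>
     (\<exists>k. p = k * of_real (- a) \<and> q = k * of_real 1) \<and> c = 0"
    unfolding Ahat2_def bc_class_condition
    by (auto simp: mat2_simps mult.commute add_eq_0_iff2)
qed (use assms in auto)

text \<open>Scaling the first row by \<open>- 1 / a\<close> turns \<open>(1, a)\<close> into
  \<open>(- 1 / a, -1)\<close>. Thus (ii) is (i) with another parameter, and the critical value of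
  \<open>1/f_0\<close> matches.\<close>

lemma Ahat2_eq_Ahat1:
  assumes "a \<noteq> 0"
  shows "Ahat2 a = Ahat1 (- 1 / a)"
proof -
  define T :: "complex^2^2" where "T = vector [vector [of_real (- 1 / a), 0], vector [0, 1]]"
  have "invertible T" using assms by (simp add: invertible_det_nz det_2 T_def)
  then show ?thesis unfolding Ahat1_def Ahat2_def
    by (subst bc_class_mult[of T, symmetric])
       (use assms in \<open>auto intro!: arg_cong2[where f = bc_class] simp: T_def mat2_simps\<close>)
qed

lemma E2_eq_E1:
  assumes "a \<noteq> 0"
  shows "E2 N a = E1 N (- 1 / a)" "E2_plus N a = E1_plus N (- 1 / a)" "E2_minus N a
    = E1_minus N (- 1 / a)"
  using assms by (simp_all add: E1_def E2_def E1_plus_def E2_plus_def E1_minus_def E2_minus_def)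

section \<open>Normal form of the boundary condition\<close>

lemma rank_2_independent:
  fixes M :: "complex^'n^2"
  assumes "rank M = 2" "\<And>k. x1 * M $ 1 $ k + x2 * M $ 2 $ k = 0"
  shows "x1 = 0 \<and> x2 = 0"
proof (rule ccontr)
  assume *: "\<not> ?thesis"
  have rows: "rows M = {M $ 1, M $ 2}"
    by (auto simp: rows_def row_def vec_lambda_eta) (metis exhaust_2)
  have "\<exists>v. rows M \<subseteq> vec.span {v}"
  proof (cases "x1 = 0")
    case False
    have "M $ 1 = (- x2 / x1) *s M $ 2" using assms(2) False
      by (simp add: vec_eq_iff field_simps add_eq_0_iff2)
    then have "M $ 1 \<in> vec.span {M $ 2}" by (metis vec.span_base vec.span_scale singletonI)
    then show ?thesis unfolding rows by (auto intro: exI[of _ "M $ 2"] vec.span_base)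
  next
    case True
    then have "x2 \<noteq> 0" using * by simp
    then have "M $ 2 = 0 *s M $ 1" using assms(2) True by (simp add: vec_eq_iff)
    then have "M $ 2 \<in> vec.span {M $ 1}" by (metis vec.span_base vec.span_scale singletonI)
    then show ?thesis unfolding rows by (auto intro: exI[of _ "M $ 1"] vec.span_base)
  qed
  then obtain v where "rows M \<subseteq> vec.span {v}" ..
  then have "vec.dim (rows M) \<le> card {v}" by (intro vec.dim_le_card) auto
  then show False using assms(1) by (simp add: row_rank_def_gen)
qed

text \<open>The row operation is \<open>T = [c x; z]\<close>, where \<open>x\<close> annihilates the first column \<open>b\<^sub>1\<close> of \<open>B\<close> and
  \<open>z\<close> annihilates \<open>A\<close> with \<open>z b\<^sub>1 = -1\<close>.\<close>

lemma classification:
  assumes BC: "\<A> \<in> BC" and A: "\<A> = bc_class A0 B0" and mu: "mu1 A0 B0 = 0" "mu2 A0 B0 = 0"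
  shows "(\<exists>a::real. \<A> = Ahat1 a) \<or> (\<exists>a::real. \<A> = Ahat2 a)"
proof -
  obtain A B where AB: "\<A> = bc_class A B" and rank: "rank (block_row A B) = 2"
    and sa: "A ** Jmat ** conj_transpose A = B ** Jmat ** conj_transpose B"
    using BC by (auto simp: BC_def)
  have "(A, B) \<in> bc_class A0 B0" using bc_class_refl[of A B] A AB by simp
  then obtain U where U: "A = U ** A0" "B = U ** B0" by (auto simp: bc_class_def)
  \<comment> \<open>A change of representative multiplies both minors by \<open>det U\<close>, so
    their vanishing passes to the pair that satisfies the rank and self-adjointness
    conditions.\<close>
  have mu1: "A $ 1 $ 1 * B $ 2 $ 2 = A $ 2 $ 1 * B $ 1 $ 2"
  proof -
    have "mu1 A B = det U * mu1 A0 B0" unfolding U mu1_def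
      by (simp add: det_2 mat2_simps algebra_simps)
    then show ?thesis using mu by (simp add: mu1_def)
  qed
  have mu2: "A $ 2 $ 2 * B $ 1 $ 2 = A $ 1 $ 2 * B $ 2 $ 2"
  proof -
    have "mu2 A B = det U * mu2 A0 B0" unfolding U mu2_def
      by (simp add: det_2 mat2_simps algebra_simps)
    then show ?thesis using mu by (simp add: mu2_def)
  qed
  have indep: "x1 = 0 \<and> x2 = 0" if "\<And>k. x1 * A $ 1 $ k + x2 * A $ 2 $ k = 0" "\<And>k. x1 * B $ 1 $ k
    + x2 * B $ 2 $ k = 0" for x1 x2
    by (rule rank_2_independent[OF rank]) (use that in \<open>auto simp: block_row_def split: sum.split\<close>)
  have sa': "A $ i $ 1 * cnj (A $ j $ 2) - A $ i $ 2 * cnj (A $ j $ 1)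
     = B $ i $ 1 * cnj (B $ j $ 2) - B $ i $ 2 * cnj (B $ j $ 1)" for i j
  proof -
    have "(M ** Jmat ** conj_transpose M) $ i $ j = M $ i $ 1 * cnj (M $ j $ 2) - M $ i $ 2
      * cnj (M $ j $ 1)" for M :: "complex^2^2"
      by (simp add: matrix_matrix_mult_def sum_2 Jmat_def conj_transpose_def map_matrix_def
        transpose_def)
    then show ?thesis using sa by metis
  qed
  \<comment> \<open>Self-adjointness expresses \<open>\<delta>\<close> times the conjugate second
    column of \<open>B\<close> through the two vanishing minors. If \<open>\<delta> = 0\<close>, the
    row \<open>(B $ 2 $ 2, - B $ 1 $ 2)\<close> annihilates every column of the block matrix, so it
    is zero by the rank condition.\<close>
  have b2: "B $ i $ 2 = 0" for i
  proof -
    define \<delta> where "\<delta> = B $ 2 $ 2 * B $ 1 $ 1 - B $ 1 $ 2 * B $ 2 $ 1"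
    have "\<delta> * cnj (B $ j $ 2) = 0" for j
    proof -
      have "\<delta> * cnj (B $ j $ 2) = B $ 2 $ 2 * (B $ 1 $ 1 * cnj (B $ j $ 2) - B $ 1 $ 2
        * cnj (B $ j $ 1))
          - B $ 1 $ 2 * (B $ 2 $ 1 * cnj (B $ j $ 2) - B $ 2 $ 2 * cnj (B $ j $ 1))"
        by (simp add: \<delta>_def algebra_simps)
      also have "\<dots> = (A $ 1 $ 1 * B $ 2 $ 2 - A $ 2 $ 1 * B $ 1 $ 2) * cnj (A $ j $ 2)
         + (A $ 2 $ 2 * B $ 1 $ 2 - A $ 1 $ 2 * B $ 2 $ 2) * cnj (A $ j $ 1)"
        unfolding sa'[symmetric] by (simp add: algebra_simps)
      also have "\<dots> = 0" using mu1 mu2 by simp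
      finally show ?thesis .
    qed
    moreover have "B $ 2 $ 2 = 0 \<and> - B $ 1 $ 2 = 0" if "\<delta> = 0"
      by (rule indep) (use mu1 mu2 that in \<open>auto simp: \<delta>_def algebra_simps dest: forall_2[THEN
        iffD1] intro: forall_2[THEN iffD2, rule_format]\<close>)
    ultimately show ?thesis using exhaust_2[of i] by (cases "\<delta> = 0") auto
  qed
  have sa0: "A $ i $ 1 * cnj (A $ j $ 2) = A $ i $ 2 * cnj (A $ j $ 1)" for i j
    using sa'[of i j] by (simp add: b2)
  \<comment> \<open>With the second column of \<open>B\<close> gone, \<open>A J A^* = 0\<close>. If
    \<open>A\<close> were invertible, the same combination of rows as before would make its second
    column zero, a contradiction.\<close>
  have detA: "A $ 1 $ 1 * A $ 2 $ 2 = A $ 1 $ 2 * A $ 2 $ 1"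
  proof (rule ccontr)
    assume *: "\<not> ?thesis"
    have "(A $ 2 $ 2 * A $ 1 $ 1 - A $ 1 $ 2 * A $ 2 $ 1) * cnj (A $ j $ 2) = 0" for j
    proof -
      have "(A $ 2 $ 2 * A $ 1 $ 1 - A $ 1 $ 2 * A $ 2 $ 1) * cnj (A $ j $ 2)
        = A $ 2 $ 2 * (A $ 1 $ 1 * cnj (A $ j $ 2)) - A $ 1 $ 2 * (A $ 2 $ 1 * cnj (A $ j $ 2))"
        by (simp add: algebra_simps)
      also have "\<dots> = 0" unfolding sa0 by simp
      finally show ?thesis .
    qed
    then have "A $ j $ 2 = 0" for j using * by (simp add: mult.commute)
    then show False using * by simp
  qed
  obtain z1 z2 where z: "(z1, z2) \<noteq> (0, 0)" "\<And>k. z1 * A $ 1 $ k + z2 * A $ 2 $ k = 0"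
  proof -
    consider "(A $ 2 $ 2, - A $ 1 $ 2) \<noteq> (0, 0)" | "(A $ 2 $ 1, - A $ 1 $ 1) \<noteq> (0
      , 0)" | "\<forall>i k. A $ i $ k = 0"
      unfolding forall_2 by auto
    then show thesis
    proof cases
      case 1
      show thesis
      proof (rule that[OF 1])
        show "A $ 2 $ 2 * A $ 1 $ k + - A $ 1 $ 2 * A $ 2 $ k = 0" for k
          using exhaust_2[of k] detA by (auto simp: mult.commute)
      qed
    next
      case 2
      show thesis
      proof (rule that[OF 2])
        show "A $ 2 $ 1 * A $ 1 $ k + - A $ 1 $ 1 * A $ 2 $ k = 0" for k
          using exhaust_2[of k] detA by (auto simp: mult.commute)
      qed
    next
      case 3
      then show thesis by (intro that[of 1 0]) auto
    qed
  qed
  define \<delta> where "\<delta> = z1 * B $ 1 $ 1 + z2 * B $ 2 $ 1"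
  have "\<delta> \<noteq> 0"
  proof
    assume "\<delta> = 0"
    then have "z1 * B $ 1 $ k + z2 * B $ 2 $ k = 0" for k using exhaust_2[of k] b2
      by (auto simp: \<delta>_def)
    then show False using indep[OF z(2)] z(1) by simp
  qed
  define v where "v k = B $ 2 $ 1 * A $ 1 $ k - B $ 1 $ 1 * A $ 2 $ k" for k
  \<comment> \<open>The row \<open>v\<close>, a combination of the rows of \<open>A\<close>,
    inherits the relation \<open>sa0\<close>. This says that \<open>v\<close> is a complex multiple
    of a real vector, so the normalized entry is real.\<close>
  have real: "v 1 * cnj (v 2) = v 2 * cnj (v 1)"
  proof -
    define D where "D i j = A $ i $ 1 * cnj (A $ j $ 2) - A $ i $ 2 * cnj (A $ j $ 1)" for i j
    have "D i j = 0" for i j using sa0[of i j] by (simp add: D_def)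
    moreover have "v 1 * cnj (v 2) - v 2 * cnj (v 1) =
        B $ 2 $ 1 * cnj (B $ 2 $ 1) * D 1 1 - B $ 2 $ 1 * cnj (B $ 1 $ 1) * D 1 2
      - B $ 1 $ 1 * cnj (B $ 2 $ 1) * D 2 1 + B $ 1 $ 1 * cnj (B $ 1 $ 1) * D 2 2"
      by (simp add: v_def D_def algebra_simps)
    ultimately show ?thesis by simp
  qed
  have nz: "v 1 \<noteq> 0 \<or> v 2 \<noteq> 0"
  proof (rule ccontr)
    assume *: "\<not> ?thesis"
    have "B $ 2 $ 1 = 0 \<and> - B $ 1 $ 1 = 0"
    proof (rule indep)
      show "B $ 2 $ 1 * A $ 1 $ k + - B $ 1 $ 1 * A $ 2 $ k = 0" for k using exhaust_2[of k] *
        by (auto simp: v_def)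
      show "B $ 2 $ 1 * B $ 1 $ k + - B $ 1 $ 1 * B $ 2 $ k = 0" for k
        using exhaust_2[of k] b2 by auto
    qed
    then show False using \<open>\<delta> \<noteq> 0\<close> by (simp add: \<delta>_def)
  qed
  have reduce: "\<A> = bc_class (vector [vector [c * v 1, c * v 2], vector [0
    , 0]]) (vector [vector [0, 0], vector [- 1, 0]])"
    if "c \<noteq> 0" for c
  proof -
    define T :: "complex^2^2" where
      "T = vector [vector [c * B $ 2 $ 1, - c * B $ 1 $ 1], vector [- z1 / \<delta>, - z2 / \<delta>]]"
    have "det T = - (c * (z1 * B $ 1 $ 1 + z2 * B $ 2 $ 1)) / \<delta>"
      by (simp add: det_2 T_def add_divide_distrib diff_divide_distrib algebra_simps)
    then have "invertible T" using that \<open>\<delta> \<noteq> 0\<close> by (simp add: invertible_det_nz flip: \<delta>_def)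
    moreover have "T ** A = vector [vector [c * v 1, c * v 2], vector [0, 0]]"
    proof -
      have "z2 * A $ 2 $ k = - (z1 * A $ 1 $ k)" for k using z(2)[of k] by (simp add: add_eq_0_iff)
      then show ?thesis by (simp add: mat2_simps T_def v_def algebra_simps)
    qed
    moreover have "T ** B = vector [vector [0, 0], vector [- 1, 0]]"
    proof -
      have "(z1 * B $ 1 $ 1 + z2 * B $ 2 $ 1) / \<delta> = 1" using \<open>\<delta> \<noteq> 0\<close> by (simp flip: \<delta>_def)
      then have "z1 * B $ 1 $ 1 / \<delta> = 1 - z2 * B $ 2 $ 1 / \<delta>"
        by (simp add: add_divide_distrib eq_diff_eq)
      then show ?thesis by (simp add: mat2_simps T_def b2)
    qed
    ultimately show ?thesis using bc_class_mult AB by metis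
  qed
  show ?thesis
  \<comment> \<open>If \<open>v 2\<close> vanishes, the class is \<open>Ahat2 0\<close>. Otherwise
    the second entry is normalized to -1, so \<open>Ahat2\<close> with a nonzero parameter already
    appears as an instance of \<open>Ahat1\<close>.\<close>
  proof (cases "v 2 = 0")
    case True
    then show ?thesis using reduce[of "1 / v 1"] nz by (auto simp: Ahat2_def intro!: exI[of _ 0])
  next
    case False
    define a where "a = - v 1 / v 2"
    have "cnj a = a" using real False by (simp add: a_def field_simps)
    then obtain r where "a = of_real r" by (metis Reals_cases Reals_cnj_iff)
    then show ?thesis using reduce[of "- 1 / v 2"] False
      by (auto simp: Ahat1_def a_def intro!: exI[of _ r])
  qed
qed

lemma E1_iff:
  assumes "a \<noteq> 0"
  shows "E1 N a = {\<omega> \<in> Omega N. 1 + rec_f \<omega> 0 * a = 0}"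
    and "E1_plus N a = {\<omega> \<in> Omega N. (1 + rec_f \<omega> 0 * a) * a > 0}"
    and "E1_minus N a = {\<omega> \<in> Omega N. (1 + rec_f \<omega> 0 * a) * a < 0}"
proof -
  have *: "(1 + r * a) * a = a\<^sup>2 * (r - (- 1 / a))" for r
    using assms by (simp add: field_simps power2_eq_square)
  have "1 + r * a = 0 \<longleftrightarrow> r = - 1 / a" for r
    using assms by (auto simp: field_simps add_eq_0_iff2)
  then show "E1 N a = {\<omega> \<in> Omega N. 1 + rec_f \<omega> 0 * a = 0}" by (simp add: E1_def)
  have "0 < a\<^sup>2 * x \<longleftrightarrow> 0 < x" "a\<^sup>2 * x < 0 \<longleftrightarrow> x < 0" for x
    using assms by (simp_all add: zero_less_mult_iff mult_less_0_iff)
  then show "E1_plus N a = {\<omega> \<in> Omega N. (1 + rec_f \<omega> 0 * a) * a > 0}"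
    and "E1_minus N a = {\<omega> \<in> Omega N. (1 + rec_f \<omega> 0 * a) * a < 0}"
    unfolding * E1_plus_def E1_minus_def by (simp_all only: diff_gt_0_iff_gt diff_less_0_iff_less)
qed

theorem theorem3p3:
  fixes N :: nat and \<A> :: bc and A B :: "complex^2^2"
  assumes "N \<ge> 2"
    and "\<A> \<in> BC" and "\<A> = bc_class A B"
    and "mu1 A B = 0" and "mu2 A B = 0"
  shows
    "((\<exists>a::real. \<A> = Ahat1 a) \<or> (\<exists>a::real. \<A> = Ahat2 a)) \<and>
     (\<forall>a::real. a \<noteq> 0 \<and> \<A> = Ahat1 a \<longrightarrow>
       (\<forall>\<omega> \<in> E1 N a. has_exactly_evs N \<omega> \<A> (N - 2)) \<and>
       (\<forall>\<omega> \<in> Omega N - E1 N a. has_exactly_evs N \<omega> \<A> (N - 1)) \<and>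
       (\<forall>n. n + 2 \<le> N \<longrightarrow> eig_continuous_on N \<A> n (Omega N - E1 N a)) \<and>
       (\<forall>n. n + 2 \<le> N \<longrightarrow>
          (\<forall>C \<in> components (E1_plus N a) \<union> components (E1_minus N a). monotonicity_M N (eig N \<A> n) C)) \<and>
       (\<forall>n. n + 2 \<le> N \<longrightarrow> (\<forall>\<omega> \<in> E1 N a. \<not> eig_continuous_at N \<A> n (Omega N) \<omega>)) \<and>
       (\<forall>\<omega>\<^sub>0 \<in> E1 N a.
          filterlim (eig N \<A> 0) at_bot (at \<omega>\<^sub>0 within E1_minus N a) \<and>
          (\<forall>n. 1 \<le> n \<and> n + 2 \<le> N \<longrightarrow>
             (eig N \<A> n \<longlongrightarrow> eig N \<A> (n - 1) \<omega>\<^sub>0) (at \<omega>\<^sub>0 within E1_minus N a)) \<and>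
          (\<forall>n. n + 3 \<le> N \<longrightarrow>
             (eig N \<A> n \<longlongrightarrow> eig N \<A> n \<omega>\<^sub>0) (at \<omega>\<^sub>0 within E1_plus N a \<union> E1 N a)) \<and>
          filterlim (eig N \<A> (N - 2)) at_top (at \<omega>\<^sub>0 within E1_plus N a)) \<and>
       (\<forall>n. n + 3 \<le> N \<longrightarrow> eig_continuous_on N \<A> n (E1_plus N a \<union> E1 N a))) \<and>
     (\<forall>a::real. a \<noteq> 0 \<and> \<A> = Ahat2 a \<longrightarrow>
       (\<forall>\<omega> \<in> E2 N a. has_exactly_evs N \<omega> \<A> (N - 2)) \<and>
       (\<forall>\<omega> \<in> Omega N - E2 N a. has_exactly_evs N \<omega> \<A> (N - 1)) \<and>
       (\<forall>n. n + 2 \<le> N \<longrightarrow> eig_continuous_on N \<A> n (Omega N - E2 N a)) \<and>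
       (\<forall>n. n + 2 \<le> N \<longrightarrow>
          (\<forall>C \<in> components (E2_plus N a) \<union> components (E2_minus N a). monotonicity_M N (eig N \<A> n) C)) \<and>
       (\<forall>n. n + 2 \<le> N \<longrightarrow> (\<forall>\<omega> \<in> E2 N a. \<not> eig_continuous_at N \<A> n (Omega N) \<omega>)) \<and>
       (\<forall>\<omega>\<^sub>0 \<in> E2 N a.
          filterlim (eig N \<A> 0) at_bot (at \<omega>\<^sub>0 within E2_minus N a) \<and>
          (\<forall>n. 1 \<le> n \<and> n + 2 \<le> N \<longrightarrow>
             (eig N \<A> n \<longlongrightarrow> eig N \<A> (n - 1) \<omega>\<^sub>0) (at \<omega>\<^sub>0 within E2_minus N a)) \<and>
          (\<forall>n. n + 3 \<le> N \<longrightarrow>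
             (eig N \<A> n \<longlongrightarrow> eig N \<A> n \<omega>\<^sub>0) (at \<omega>\<^sub>0 within E2_plus N a \<union> E2 N a)) \<and>
          filterlim (eig N \<A> (N - 2)) at_top (at \<omega>\<^sub>0 within E2_plus N a)) \<and>
       (\<forall>n. n + 3 \<le> N \<longrightarrow> eig_continuous_on N \<A> n (E2_plus N a \<union> E2 N a))) \<and>
     (\<A> = Ahat1 0 \<or> \<A> = Ahat2 0 \<longrightarrow>
       (\<forall>\<omega> \<in> Omega N. has_exactly_evs N \<omega> \<A> (N - 1)) \<and>
       (\<forall>n. n + 2 \<le> N \<longrightarrow> eig_continuous_on N \<A> n (Omega N)) \<and>
       (\<forall>n. n + 2 \<le> N \<longrightarrow> (\<forall>C \<in> components (Omega N). monotonicity_M N (eig N \<A> n) C)))"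
proof (rule conjI[OF classification[OF assms(2-5)]],
    rule conjI[OF allI[OF impI] conjI[OF allI[OF impI] impI]], goal_cases)
  case (1 a)
  interpret sl_problem N 1 a "Ahat1 a" by (rule sl_problem_Ahat1[OF assms(1)])
  show ?case using singular_case[unfolded S_def, OF E1_iff] 1 by simp
next
  case (2 a)
  interpret sl_problem N 1 "- 1 / a" "Ahat1 (- 1 / a)" by (rule sl_problem_Ahat1[OF assms(1)])
  have a: "a \<noteq> 0" "- 1 / a \<noteq> 0" "\<A> = Ahat1 (- 1 / a)" using 2 Ahat2_eq_Ahat1 by auto
  show ?case unfolding E2_eq_E1[OF a(1)] a(3)
    by (rule singular_case[unfolded S_def, OF E1_iff[OF a(2)]])
next
  \<comment> \<open>There are no degenerate equations here: \<open>S\<close> is 1 in the first case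
    and \<open>1/f_0\<close> in the second.\<close>
  case 3
  then show ?case
  proof
    assume A: "\<A> = Ahat1 0"
    interpret sl_problem N 1 0 "Ahat1 0" using sl_problem_Ahat1[OF assms(1), of 0] by simp
    show ?case unfolding A by (rule regular_case) (simp add: S_def)
  next
    assume A: "\<A> = Ahat2 0"
    interpret sl_problem N 0 1 "Ahat2 0" using sl_problem_Ahat2[OF assms(1), of 0] by simp
    show ?case unfolding A by (rule regular_case) (use rec_f_nz[of _ 0] in \<open>simp add: S_def\<close>)
  qed
qed

end
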